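(* Let $\boldsymbol X_\star\in\mathbb R^{n_1\times n_2}$ have rank $r$ and SVD $\boldsymbol X_\star=\boldsymbol U_\star\boldsymbol\Sigma_\star\boldsymbol V_\star^\top$, let $\mathcal A:\mathbb R^{n_1\times n_2}\to\mathbb R^m$ be a linear operator, $\boldsymbol y=\mathcal A(\boldsymbol X_\star)$, and let $\boldsymbol\Theta\in\mathbb R^{n_1n_2\times n_1n_2}$ be the matrix of $\mathcal A^*\mathcal A$ under vectorization. Let $(\boldsymbol X_t)$ be generated by the Riemannian gradient descent (RGrad) algorithm (defined in the context), using either the projective retraction or the orthographic retraction, and let $\boldsymbol e_t=\mathrm{vec}(\boldsymbol X_t-\boldsymbol X_\star)$. When $\boldsymbol X_t$ lies in the basin of attraction of $\boldsymbol X_\star$, the residuals satisfy, up to second-order terms, the same recursion as the Euclidean projected gradient method, namely $$\boldsymbol e_{t+1}=(\boldsymbol I-P_{\boldsymbol V_\star}^\perp\otimes P_{\boldsymbol U_\star}^\perp)(\boldsymbol I-\mu_t\boldsymbol\Theta)\,\boldsymbol e_t+\mathcal O(\|\boldsymbol e_t\|_2^2).$$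
   Context: $\mathcal A^*$ is the adjoint of $\mathcal A$. The loss is $f(\boldsymbol X)=\tfrac12\|\mathcal A(\boldsymbol X)-\boldsymbol y\|_2^2$, with gradient $\nabla f(\boldsymbol X)=\mathcal A^*(\mathcal A(\boldsymbol X-\boldsymbol X_\star))$; $\boldsymbol\Theta$ is defined by $\mathrm{vec}(\mathcal A^*\mathcal A(\boldsymbol E))=\boldsymbol\Theta\,\mathrm{vec}(\boldsymbol E)$ for all $\boldsymbol E$. For a matrix $\boldsymbol U$ with orthonormal columns, $P_{\boldsymbol U}=\boldsymbol U\boldsymbol U^\top$ and $P_{\boldsymbol U}^\perp=\boldsymbol I-P_{\boldsymbol U}$. $\boldsymbol U_\star\in\mathbb R^{n_1\times r}$ and $\boldsymbol V_\star\in\mathbb R^{n_2\times r}$ have orthonormal columns. $\otimes$ is the Kronecker product and $\mathrm{vec}$ is column-stacking vectorization. For a rank-$r$ matrix $\boldsymbol X=\boldsymbol U_{\boldsymbol X}\boldsymbol\Sigma_{\boldsymbol X}\boldsymbol V_{\boldsymbol X}^\top$: tangent projection $\mathcal P_{\mathbb T_{\boldsymbol X}}(\boldsymbol Z)=P_{\boldsymbol U_{\boldsymbol X}}\boldsymbol Z+\boldsymbol ZP_{\boldsymbol V_{\boldsymbol X}}-P_{\boldsymbol U_{\boldsymbol X}}\boldsymbol ZP_{\boldsymbol V_{\boldsymbol X}}$; Riemannian gradient $\mathrm{grad}f(\boldsymbol X)=\mathcal P_{\mathbb T_{\boldsymbol X}}(\nabla f(\boldsymbol X))$; projective retraction $\mathcal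 R^{\mathsf{proj}}_{\boldsymbol X}(\boldsymbol\delta)=\mathcal P_r(\boldsymbol X+\boldsymbol\delta)$ with $\mathcal P_r$ the rank-$r$ truncated SVD; orthographic retraction $\mathcal R^{\mathsf{orth}}_{\boldsymbol X}(\boldsymbol\delta)=(\boldsymbol X+\boldsymbol\delta)\boldsymbol V_{\boldsymbol X}[\boldsymbol U_{\boldsymbol X}^\top(\boldsymbol X+\boldsymbol\delta)\boldsymbol V_{\boldsymbol X}]^{-1}\boldsymbol U_{\boldsymbol X}^\top(\boldsymbol X+\boldsymbol\delta)$. RGrad algorithm: $\boldsymbol X_0=\mathcal A^*(\boldsymbol y)$ and, for $t\ge0$, $$\mu_t=\frac{\|\mathrm{grad}f(\boldsymbol X_t)\|_F^2}{\|\mathcal A(\mathrm{grad}f(\boldsymbol X_t))\|_2^2},\qquad \boldsymbol X_{t+1}=\mathcal R_{\boldsymbol X_t}(-\mu_t\,\mathrm{grad}f(\boldsymbol X_t)),$$ where $\mathcal R$ is $\mathcal R^{\mathsf{proj}}$ or $\mathcal R^{\mathsf{orth}}$. Basin of attraction: $\|\boldsymbol X_t-\boldsymbol X_\star\|_F\asymp\sigma_r(\boldsymbol X_\star)$, i.e. $\boldsymbol X_t$ lies within a local radius of $\boldsymbol X_\star$ that equals $\sigma_r(\boldsymbol X_\star)$ (the $r$-th singular value) up to a constant: $\|\boldsymbol X_t-\boldsymbol X_\star\|_F\le c\,\sigma_r(\boldsymbol X_\star)$ for a suitable constant $c>0$.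
   Formalization: The recursion is proved at steps where μ_t‖A‖² ≤ κ, for arbitrary κ; the basin constant c and the constant in O(‖e_t‖²) (of the form C/σ_r) depend on κ. With no bound on the step size, the remainder can be of order ‖e_t‖. *)

theory Defs
  imports "HOL-Analysis.Analysis"
begin

text \<open>
  Matrices with \<open>n1\<close> rows and \<open>n2\<close> columns have type \<open>real^'n2^'n1\<close>. On this type the library's
  \<open>inner\<close> and \<open>norm\<close> are the Frobenius inner product and norm, so \<open>adjoint\<close> and \<open>onorm\<close> are taken
  with respect to these.
\<close>

text \<open>
  Entry \<open>X $ i $ j\<close> is stored at index \<open>(j, i)\<close>: listing index pairs lexicographically (column
  number first) gives the column-stacking order. With this indexing \<open>kron P Q\<close> has block
  \<open>(j, j')\<close> equal to \<open>P $ j $ j' *\<^sub>R Q\<close>.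
\<close>

definition vectorize :: "real^'n2^'n1 \<Rightarrow> real^('n2 \<times> 'n1)" where
  "vectorize X = (\<chi> p. X $ snd p $ fst p)"

definition kron :: "real^'b^'a \<Rightarrow> real^'d^'c \<Rightarrow> real^('b \<times> 'd)^('a \<times> 'c)" where
  "kron P Q = (\<chi> p q. P $ fst p $ fst q * Q $ snd p $ snd q)"

lemma vectorize_matrix_mult:
  fixes P :: "real^'n2^'b" and Q :: "real^'n1^'a" and X :: "real^'n2^'n1"
  shows "vectorize (Q ** X ** transpose P) = kron P Q *v vectorize X"
proof -
  have "(Q ** X ** transpose P) $ i $ j = (\<Sum>q\<in>UNIV. P $ j $ fst q * Q $ i $ snd q * X $ snd q $ fst q)"
    for i j
  proof -
    have "(Q ** X ** transpose P) $ i $ j = (\<Sum>k\<in>UNIV. \<Sum>l\<in>UNIV. P $ j $ k * Q $ i $ l * X $ l $ k)"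
      by (simp add: matrix_matrix_mult_def transpose_def sum_distrib_left sum_distrib_right mult_ac)
    also have "\<dots> = (\<Sum>q\<in>UNIV \<times> UNIV. P $ j $ fst q * Q $ i $ snd q * X $ snd q $ fst q)"
      by (simp add: sum.cartesian_product case_prod_beta)
    finally show ?thesis by simp
  qed
  then show ?thesis
    by (simp add: vec_eq_iff vectorize_def kron_def matrix_vector_mult_def)
qed

lemma norm_vectorize: "norm (vectorize X) = norm X"
proof -
  have "(\<Sum>p\<in>UNIV. (X $ snd p $ fst p)\<^sup>2) = (\<Sum>i\<in>UNIV. \<Sum>j\<in>UNIV. (X $ i $ j)\<^sup>2)"
    by (subst sum.swap)
      (simp add: sum.cartesian_product case_prod_beta flip: UNIV_Times_UNIV)
  then show ?thesis
    by (simp add: vectorize_def norm_vec_def L2_set_def real_sqrt_pow2 sum_nonneg)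
qed

definition diag :: "real^'r \<Rightarrow> real^'r^'r" where
  "diag s = (\<chi> i j. if i = j then s $ i else 0)"

definition range_proj :: "real^'r^'n \<Rightarrow> real^'n^'n" where
  "range_proj U = U ** transpose U"

definition range_perp :: "real^'r^'n \<Rightarrow> real^'n^'n" where
  "range_perp U = mat 1 - range_proj U"

text \<open>
  Compact singular value decomposition \<open>X = U \<Sigma> V\<^sup>T\<close> of a matrix of rank \<open>CARD('r)\<close>. The index
  type \<open>'r\<close> carries no order, so the singular values are not required to be sorted; the
  \<open>r\<close>-th (smallest) one is \<open>min_entry s\<close>.
\<close>

definition compact_svd :: "real^'n2^'n1 \<Rightarrow> real^'r^'n1 \<Rightarrow> real^'r \<Rightarrow> real^'r^'n2 \<Rightarrow> bool" where
  "compact_svd X U s V \<longleftrightarrow>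
     transpose U ** U = mat 1 \<and> transpose V ** V = mat 1 \<and> (\<forall>k. 0 < s $ k) \<and>
     X = U ** diag s ** transpose V"

definition min_entry :: "real^'r \<Rightarrow> real" where
  "min_entry s = Min (range (\<lambda>k. s $ k))"

text \<open>
  Singular value decomposition of an arbitrary matrix, with singular values
  \<open>\<sigma> 0 \<ge> \<sigma> 1 \<ge> \<dots> \<ge> 0\<close>; only indices below \<open>min n1 n2\<close> are meaningful.
\<close>

definition svd ::
    "real^'n2^'n1 \<Rightarrow> (nat \<Rightarrow> real) \<Rightarrow> (nat \<Rightarrow> real^'n1) \<Rightarrow> (nat \<Rightarrow> real^'n2) \<Rightarrow> bool" where
  "svd X \<sigma> u v \<longleftrightarrow> (let p = min CARD('n1) CARD('n2) in
     (\<forall>i<p. \<forall>j<p. u i \<bullet> u j = (if i = j then 1 else 0)) \<and>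
     (\<forall>i<p. \<forall>j<p. v i \<bullet> v j = (if i = j then 1 else 0)) \<and>
     (\<forall>i<p. 0 \<le> \<sigma> i) \<and> (\<forall>j<p. \<forall>i\<le>j. \<sigma> j \<le> \<sigma> i) \<and>
     X = (\<Sum>k<p. \<sigma> k *\<^sub>R (\<chi> i j. u k $ i * v k $ j)))"

text \<open>
  The factors of the leading \<open>r = CARD('r)\<close> singular triplets of \<open>X\<close> (in an arbitrary enumeration
  \<open>\<phi>\<close> by \<open>'r\<close>), for some choice of the singular value decomposition of \<open>X\<close>.
\<close>

definition truncated_svd :: "real^'n2^'n1 \<Rightarrow> real^'r^'n1 \<Rightarrow> real^'r \<Rightarrow> real^'r^'n2 \<Rightarrow> bool" where
  "truncated_svd X U s V \<longleftrightarrow> CARD('r) \<le> min CARD('n1) CARD('n2) \<and>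
     (\<exists>\<sigma> u v. \<exists>\<phi> :: 'r \<Rightarrow> nat. svd X \<sigma> u v \<and> bij_betw \<phi> UNIV {..<CARD('r)} \<and>
        U = (\<chi> i k. u (\<phi> k) $ i) \<and> s = (\<chi> k. \<sigma> (\<phi> k)) \<and> V = (\<chi> j k. v (\<phi> k) $ j))"

definition loss :: "(real^'n2^'n1 \<Rightarrow> real^'m) \<Rightarrow> real^'m \<Rightarrow> real^'n2^'n1 \<Rightarrow> real" where
  "loss A y X = 1/2 * (norm (A X - y))\<^sup>2"

definition loss_grad :: "(real^'n2^'n1 \<Rightarrow> real^'m) \<Rightarrow> real^'m \<Rightarrow> real^'n2^'n1 \<Rightarrow> real^'n2^'n1" where
  "loss_grad A y X = adjoint A (A X - y)"

lemma GDERIV_loss: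
  assumes "linear A"
  shows "GDERIV (loss A y) X :> loss_grad A y X"
proof -
  have A: "(A has_derivative A) (at X)"
    using assms by (simp add: linear_imp_has_derivative)
  have "((\<lambda>X. 1/2 * ((A X - y) \<bullet> (A X - y))) has_derivative
      (\<lambda>h. 1/2 * ((A X - y) \<bullet> A h + A h \<bullet> (A X - y)))) (at X)"
    by (rule derivative_eq_intros A refl | simp)+
  moreover have "1/2 * ((A X - y) \<bullet> A h + A h \<bullet> (A X - y)) = h \<bullet> loss_grad A y X" for h
    using adjoint_works[OF assms, of h "A X - y"]
    by (simp add: loss_grad_def inner_commute)
  ultimately show ?thesis
    by (simp add: gderiv_def loss_def[abs_def] power2_norm_eq_inner)
qed

definition tangent_proj :: "real^'r^'n1 \<Rightarrow> real^'r^'n2 \<Rightarrow> real^'n2^'n1 \<Rightarrow> real^'n2^'n1" where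
  "tangent_proj U V Z =
     range_proj U ** Z + Z ** range_proj V - range_proj U ** Z ** range_proj V"

definition riem_grad ::
    "(real^'n2^'n1 \<Rightarrow> real^'m) \<Rightarrow> real^'m \<Rightarrow> real^'r^'n1 \<Rightarrow> real^'r^'n2 \<Rightarrow> real^'n2^'n1 \<Rightarrow> real^'n2^'n1" where
  "riem_grad A y U V X = tangent_proj U V (loss_grad A y X)"

datatype retraction = Projective | Orthographic

text \<open>
  \<open>retracts R U V X \<delta> Z\<close>: \<open>Z\<close> is the retraction of the step \<open>\<delta>\<close> at \<open>X\<close>, where \<open>U\<close>, \<open>V\<close> are the
  singular factors of \<open>X\<close>. It is a relation because the truncated singular value decomposition
  of \<open>X + \<delta>\<close> need not be unique. Where the \<open>r \<times> r\<close> core matrix is singular the orthographic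
  retraction is undefined, and here \<open>matrix_inv\<close> has an unspecified value.
\<close>

fun retracts ::
    "retraction \<Rightarrow> real^'r^'n1 \<Rightarrow> real^'r^'n2 \<Rightarrow> real^'n2^'n1 \<Rightarrow> real^'n2^'n1 \<Rightarrow> real^'n2^'n1 \<Rightarrow> bool" where
  "retracts Projective U V X \<delta> Z \<longleftrightarrow>
     (\<exists>(U' :: real^'r^'n1) s' (V' :: real^'r^'n2).
        truncated_svd (X + \<delta>) U' s' V' \<and> Z = U' ** diag s' ** transpose V')"
| "retracts Orthographic U V X \<delta> Z \<longleftrightarrow>
     Z = (X + \<delta>) ** V ** matrix_inv (transpose U ** (X + \<delta>) ** V) ** transpose U ** (X + \<delta>)"

text \<open>
  A run of Riemannian gradient descent for rank \<open>r = CARD('r)\<close>, with iterates \<open>X t\<close>, singular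
  factors \<open>U t\<close>, \<open>V t\<close> and step sizes \<open>\<mu> t\<close>. For an iterate of rank \<open>r\<close>, \<open>U t\<close> and \<open>V t\<close> are its
  left and right singular factors. The initial matrix \<open>adjoint A y\<close> may have a different rank;
  its leading \<open>r\<close> singular vectors are used. If the Riemannian gradient vanishes, \<open>\<mu> t\<close> is
  \<open>0 / 0 = 0\<close>.
\<close>

definition rgrad_run ::
    "retraction \<Rightarrow> (real^'n2^'n1 \<Rightarrow> real^'m) \<Rightarrow> real^'m \<Rightarrow> (nat \<Rightarrow> real^'n2^'n1) \<Rightarrow>
     (nat \<Rightarrow> real^'r^'n1) \<Rightarrow> (nat \<Rightarrow> real^'r^'n2) \<Rightarrow> (nat \<Rightarrow> real) \<Rightarrow> bool" where
  "rgrad_run R A y X U V \<mu> \<longleftrightarrow>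
     X 0 = adjoint A y \<and>
     (\<forall>t. (\<exists>s. truncated_svd (X t) (U t) s (V t)) \<and>
       (let G = riem_grad A y (U t) (V t) (X t) in
          \<mu> t = (norm G)\<^sup>2 / (norm (A G))\<^sup>2 \<and>
          retracts R (U t) (V t) (X t) (- (\<mu> t *\<^sub>R G)) (X (Suc t))))"

end

theory Submission
  imports Defs
begin

text \<open>
  Both retractions send a point \<open>W\<close> near \<open>Xs\<close> to \<open>W - P\<^sub>U\<^sup>\<bottom> W P\<^sub>V\<^sup>\<bottom>\<close> up to second order. For the
  truncated singular value decomposition, with \<open>U\<close>, \<open>V\<close> the leading singular factors of \<open>W\<close>, this
  is an identity. For the orthographic retraction, with \<open>U\<close>, \<open>V\<close> the factors of the current
  iterate, the defect is \<open>W\<^sub>2\<^sub>1 W\<^sub>1\<^sub>1\<^sup>-\<^sup>1 W\<^sub>1\<^sub>2\<close> in the block form of \<open>W\<close> with respect to \<open>U\<close>, \<open>V\<close>. In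
  either case \<open>U\<close>, \<open>V\<close> are the leading singular factors of some matrix \<open>M\<close> near \<open>Xs\<close>, of any rank,
  and the Ky Fan maximum principle gives \<open>\<parallel>P\<^sub>U\<^sup>\<bottom> Xs\<parallel> \<le> 2 \<parallel>M - Xs\<parallel>\<close>. Dividing by \<open>\<sigma>\<^sub>r\<close> bounds the
  distance of the projections to those of \<open>Us\<close>, \<open>Vs\<close>, so replacing one by the other costs only
  second-order terms.
\<close>


section \<open>Matrix algebra and the Frobenius norm\<close>

lemma matrix_diff_ldistrib: "A ** (B - C) = A ** B - A ** (C :: real^'k^'m)"
  by (simp add: matrix_matrix_mult_def vec_eq_iff right_diff_distrib sum_subtractf)

lemma matrix_diff_rdistrib: "(A - B) ** C = A ** C - B ** (C :: real^'k^'m)"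
  by (simp add: matrix_matrix_mult_def vec_eq_iff left_diff_distrib sum_subtractf)

lemma matrix_add_rdistrib_real: "(A + B) ** C = A ** C + B ** (C :: real^'k^'m)"
  by (simp add: matrix_matrix_mult_def vec_eq_iff distrib_right sum.distrib)

lemmas matrix_distribs =
  matrix_diff_ldistrib matrix_diff_rdistrib matrix_add_ldistrib matrix_add_rdistrib_real

lemma transpose_diff: "transpose (A - B) = transpose A - transpose (B :: real^'k^'m)"
  by (simp add: transpose_def vec_eq_iff)

lemma inner_matrix_eq_sum: "A \<bullet> B = (\<Sum>i\<in>UNIV. \<Sum>j\<in>UNIV. A $ i $ j * (B :: real^'n^'m) $ i $ j)"
  by (simp add: inner_vec_def)

lemma norm_vec_square: "(norm x)\<^sup>2 = (\<Sum>i\<in>UNIV. (norm (x $ i))\<^sup>2)" for x :: "'a::real_inner^'n"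
  by (simp only: power2_norm_eq_inner inner_vec_def)

lemma norm_matrix_square: "(norm N)\<^sup>2 = (\<Sum>i\<in>UNIV. \<Sum>j\<in>UNIV. (N $ i $ j)\<^sup>2)" for N :: "real^'n^'m"
  unfolding power2_norm_eq_inner inner_matrix_eq_sum by (simp only: power2_eq_square)

lemma inner_transpose: "transpose A \<bullet> transpose B = A \<bullet> (B :: real^'n^'m)"
  unfolding inner_matrix_eq_sum transpose_def by (subst sum.swap) simp

lemma norm_transpose: "norm (transpose A) = norm (A :: real^'n^'m)"
  by (simp add: norm_eq_sqrt_inner inner_transpose)

lemma inner_matrix_mult_left:
  fixes A :: "real^'k^'m" and B :: "real^'n^'k"
  shows "(A ** B) \<bullet> C = B \<bullet> (transpose A ** C)"
proof -
  have "(A ** B) \<bullet> C = (\<Sum>i\<in>UNIV. \<Sum>j\<in>UNIV. \<Sum>k\<in>UNIV. A $ i $ k * B $ k $ j * C $ i $ j)"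
    by (simp add: inner_matrix_eq_sum matrix_matrix_mult_def sum_distrib_right)
  also have "\<dots> = (\<Sum>i\<in>UNIV. \<Sum>k\<in>UNIV. \<Sum>j\<in>UNIV. A $ i $ k * B $ k $ j * C $ i $ j)"
    by (intro sum.cong refl sum.swap)
  also have "\<dots> = (\<Sum>k\<in>UNIV. \<Sum>i\<in>UNIV. \<Sum>j\<in>UNIV. A $ i $ k * B $ k $ j * C $ i $ j)"
    by (rule sum.swap)
  also have "\<dots> = (\<Sum>k\<in>UNIV. \<Sum>j\<in>UNIV. \<Sum>i\<in>UNIV. A $ i $ k * B $ k $ j * C $ i $ j)"
    by (intro sum.cong refl sum.swap)
  also have "\<dots> = B \<bullet> (transpose A ** C)"
    by (simp add: inner_matrix_eq_sum matrix_matrix_mult_def transpose_def sum_distrib_left mult_ac)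
  finally show ?thesis .
qed

text \<open>Each entry of the product is the inner product of a row of \<open>A\<close> with a
  column of \<open>B\<close>, so Cauchy-Schwarz applies entrywise and the squared bounds sum to a
  product.\<close>

lemma norm_matrix_mult_le: "norm (A ** B) \<le> norm A * norm (B :: real^'n^'k)" for A :: "real^'k^'m"
proof -
  have "(norm (A ** B))\<^sup>2 = (\<Sum>i\<in>UNIV. \<Sum>j\<in>UNIV. (A $ i \<bullet> transpose B $ j)\<^sup>2)"
    unfolding norm_matrix_square
    by (simp add: matrix_matrix_mult_def inner_vec_def transpose_def)
  also have "\<dots> \<le> (\<Sum>i\<in>UNIV. \<Sum>j\<in>UNIV. (norm (A $ i))\<^sup>2 * (norm (transpose B $ j))\<^sup>2)"
    unfolding power2_norm_eq_inner by (intro sum_mono Cauchy_Schwarz_ineq)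
  also have "\<dots> = (norm A)\<^sup>2 * (norm (transpose B))\<^sup>2"
    by (simp only: norm_vec_square[of A] norm_vec_square[of "transpose B"] sum_product)
  also have "\<dots> = (norm A * norm B)\<^sup>2"
    by (simp only: norm_transpose power_mult_distrib)
  finally show ?thesis
    by (rule power2_le_imp_le) simp
qed

lemma norm_contraction_proj_left:
  fixes Q :: "real^'n^'n"
  assumes "transpose Q = Q" "Q ** Q = Q"
  shows "norm (Q ** M) \<le> norm (M :: real^'k^'n)"
proof -
  have "(norm (Q ** M))\<^sup>2 = M \<bullet> (Q ** M)"
    using assms by (simp add: power2_norm_eq_inner inner_matrix_mult_left matrix_mul_assoc)
  also have "\<dots> \<le> norm M * norm (Q ** M)"
    by (rule norm_cauchy_schwarz)
  finally show ?thesis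
    by (cases "norm (Q ** M) = 0") (simp_all add: power2_eq_square)
qed

section \<open>Projections onto column spaces and the angles between such spaces\<close>

lemma transpose_range_proj [simp]: "transpose (range_proj U) = range_proj U"
  by (simp add: range_proj_def matrix_transpose_mul)

lemma transpose_range_perp [simp]: "transpose (range_perp U) = range_perp U"
  by (simp add: range_perp_def transpose_diff)

lemma range_proj_idem: "transpose U ** U = mat 1 \<Longrightarrow> range_proj U ** range_proj U = range_proj U"
  by (simp add: range_proj_def matrix_mul_assoc)
    (simp flip: matrix_mul_assoc)

lemma range_perp_idem: "transpose U ** U = mat 1 \<Longrightarrow> range_perp U ** range_perp U = range_perp U"
  by (simp add: range_perp_def matrix_distribs range_proj_idem)

lemma range_perp_mult_self: "transpose U ** U = mat 1 \<Longrightarrow> range_perp U ** U = 0"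
  by (simp add: range_perp_def matrix_distribs range_proj_def flip: matrix_mul_assoc)

lemma norm_range_perp_mult_le:
  "transpose U ** U = mat 1 \<Longrightarrow> norm (range_perp U ** M) \<le> norm M"
  by (intro norm_contraction_proj_left) (simp_all add: range_perp_idem)

lemma norm_mult_range_perp_le:
  "transpose U ** U = mat 1 \<Longrightarrow> norm (M ** range_perp U) \<le> norm M"
  using norm_range_perp_mult_le[of U "transpose M"] norm_transpose[of "M ** range_perp U"]
  by (simp add: matrix_transpose_mul norm_transpose)

lemma norm_orthonormal_mult:
  "transpose U ** U = mat 1 \<Longrightarrow> norm (U ** M) = norm M" for M :: "real^'k^'r"
  by (simp only: norm_eq_sqrt_inner inner_matrix_mult_left matrix_mul_assoc matrix_mul_lid)

lemma norm_mult_orthonormal_transpose: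
  "transpose U ** U = mat 1 \<Longrightarrow> norm (M ** transpose U) = norm M" for M :: "real^'r^'k"
  using norm_orthonormal_mult[of U "transpose M"] norm_transpose[of "M ** transpose U"]
  by (simp add: matrix_transpose_mul norm_transpose)

lemma norm_range_proj_mult:
  "transpose U ** U = mat 1 \<Longrightarrow> norm (range_proj U ** M) = norm (transpose U ** M)"
  using norm_orthonormal_mult[of U "transpose U ** M"]
  by (simp add: range_proj_def matrix_mul_assoc)

lemma norm_orthonormal_transpose_mult_le:
  "transpose U ** U = mat 1 \<Longrightarrow> norm (transpose U ** M) \<le> norm M" for M :: "real^'k^'n"
  using norm_contraction_proj_left[of "range_proj U" M]
  by (simp add: norm_range_proj_mult range_proj_idem)

lemma norm_mult_orthonormal_le:
  "transpose U ** U = mat 1 \<Longrightarrow> norm (M ** U) \<le> norm M" for M :: "real^'n^'k"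
  using norm_orthonormal_transpose_mult_le[of U "transpose M"] norm_transpose[of "M ** U"]
  by (simp add: matrix_transpose_mul norm_transpose)

lemma range_proj_add_range_perp: "range_proj U ** M + range_perp U ** M = M"
  by (simp add: range_perp_def matrix_distribs)

lemma range_perp_mult: "range_perp U ** M = M - range_proj U ** M"
  by (simp add: range_perp_def matrix_distribs)

lemma mult_range_perp: "M ** range_perp U = M - M ** range_proj U"
  by (simp add: range_perp_def matrix_distribs)

text \<open>Pythagoras for the column space of \<open>U\<close>. It turns the Ky Fan principle,
  which maximises the captured part \<open>transpose U ** M\<close>, into a bound on the part left
  over.\<close>

lemma norm_range_perp_mult_square:
  assumes "transpose U ** U = mat 1"
  shows "(norm (range_perp U ** M))\<^sup>2 = (norm M)\<^sup>2 - (norm (transpose U ** M))\<^sup>2"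
proof -
  have "(range_perp U ** M) \<bullet> (range_perp U ** M) = M \<bullet> M - M \<bullet> (range_proj U ** M)"
    using assms by (simp add: inner_matrix_mult_left matrix_mul_assoc range_perp_idem)
      (simp add: range_perp_mult inner_diff_right)
  moreover have "M \<bullet> (range_proj U ** M) = (transpose U ** M) \<bullet> (transpose U ** M)"
    by (simp add: inner_matrix_mult_left range_proj_def matrix_mul_assoc)
  ultimately show ?thesis
    by (simp add: power2_norm_eq_inner)
qed

text \<open>Both squares equal \<open>CARD('r)\<close> minus the squared norm of
  \<open>transpose U ** U'\<close>: the two column spaces have the same dimension, so the sines of
  their principal angles do not depend on the order.\<close>

lemma norm_range_perp_mult_commute:
  fixes U U' :: "real^'r^'n"
  assumes "transpose U ** U = mat 1" "transpose U' ** U' = mat 1"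
  shows "norm (range_perp U ** U') = norm (range_perp U' ** U)"
proof -
  have "norm U = norm U'"
    using norm_orthonormal_mult[OF assms(1), of "mat 1"] norm_orthonormal_mult[OF assms(2), of "mat 1"]
    by simp
  moreover have "norm (transpose U ** U') = norm (transpose U' ** U)"
    using norm_transpose[of "transpose U ** U'"] by (simp add: matrix_transpose_mul)
  ultimately have "(norm (range_perp U ** U'))\<^sup>2 = (norm (range_perp U' ** U))\<^sup>2"
    using assms by (simp add: norm_range_perp_mult_square)
  then show ?thesis
    by simp
qed

lemma norm_range_proj_mult_range_perp:
  assumes "transpose U' ** U' = mat 1"
  shows "norm (range_proj U' ** range_perp U) = norm (range_perp U ** U')"
proof -
  have "norm (range_proj U' ** range_perp U) = norm (transpose U' ** range_perp U)"
    using assms by (rule norm_range_proj_mult)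
  also have "\<dots> = norm (transpose (range_perp U ** U'))"
    by (simp add: matrix_transpose_mul)
  finally show ?thesis
    by (simp add: norm_transpose)
qed

lemma norm_range_perp_mult_range_proj:
  assumes "transpose U' ** U' = mat 1"
  shows "norm (range_perp U ** range_proj U') = norm (range_perp U ** U')"
  using norm_mult_orthonormal_transpose[OF assms, of "range_perp U ** U'"]
  by (simp add: range_proj_def matrix_mul_assoc)

text \<open>The difference is \<open>range_proj U' ** range_perp U - range_perp U' ** range_proj
  U\<close>, and each of the two products has the norm of the sine matrix
  \<open>range_perp U ** U'\<close>.\<close>

lemma norm_range_perp_diff_le:
  fixes U U' :: "real^'r^'n"
  assumes U: "transpose U ** U = mat 1" and U': "transpose U' ** U' = mat 1"
  shows "norm (range_perp U - range_perp U') \<le> 2 * norm (range_perp U ** U')"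
proof -
  have "range_perp U - range_perp U' = range_proj U' ** range_perp U - range_perp U' ** range_proj U"
    by (simp add: range_perp_def matrix_distribs)
  then have "norm (range_perp U - range_perp U')
      \<le> norm (range_proj U' ** range_perp U) + norm (range_perp U' ** range_proj U)"
    by (metis norm_triangle_ineq4)
  then show ?thesis
    using norm_range_perp_mult_commute[OF U U']
    by (simp add: norm_range_proj_mult_range_perp[OF U'] norm_range_perp_mult_range_proj[OF U])
qed

lemma tangent_proj_eq: "tangent_proj U V Z = Z - range_perp U ** Z ** range_perp V"
  by (simp add: tangent_proj_def range_perp_def matrix_distribs)

section \<open>Diagonal factors and the smallest singular value\<close>

lemma min_entry_le: "min_entry s \<le> s $ k"
  by (simp add: min_entry_def)

lemma min_entry_pos: "(\<And>k. 0 < s $ k) \<Longrightarrow> 0 < min_entry s"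
  by (auto simp: min_entry_def)

lemma transpose_diag [simp]: "transpose (diag s) = diag s"
  by (simp add: diag_def transpose_def vec_eq_iff)

lemma diag_mult_nth: "(diag s ** M) $ i $ j = s $ i * M $ i $ j"
  by (simp add: diag_def matrix_matrix_mult_def if_distrib[where f = "\<lambda>x. x * _"] cong: if_cong)

lemma min_entry_norm_le_norm_diag_mult:
  assumes "0 \<le> min_entry s"
  shows "min_entry s * norm M \<le> norm (diag s ** (M :: real^'b^'a))"
proof -
  have "(min_entry s * norm M)\<^sup>2 = (\<Sum>i\<in>UNIV. \<Sum>j\<in>UNIV. (min_entry s)\<^sup>2 * (M $ i $ j)\<^sup>2)"
    by (simp add: power_mult_distrib norm_matrix_square sum_distrib_left)
  also have "\<dots> \<le> (\<Sum>i\<in>UNIV. \<Sum>j\<in>UNIV. (s $ i)\<^sup>2 * (M $ i $ j)\<^sup>2)"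
    using assms min_entry_le[of s]
    by (intro sum_mono mult_right_mono power_mono) auto
  also have "\<dots> = (norm (diag s ** M))\<^sup>2"
    by (simp add: norm_matrix_square diag_mult_nth power_mult_distrib)
  finally show ?thesis
    by (rule power2_le_imp_le) simp
qed

lemma min_entry_norm_le_norm_mult_diag:
  "0 \<le> min_entry s \<Longrightarrow> min_entry s * norm M \<le> norm (M ** diag s)"
  using min_entry_norm_le_norm_diag_mult[of s "transpose M"] norm_transpose[of "M ** diag s"]
  by (simp add: matrix_transpose_mul norm_transpose)

lemma compact_svd_transpose: "compact_svd X U s V \<Longrightarrow> compact_svd (transpose X) V s U"
  unfolding compact_svd_def by (elim conjE) (simp only: matrix_transpose_mul transpose_transpose
      transpose_diag matrix_mul_assoc simp_thms)

section \<open>Orthonormal systems and weighted sums\<close>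

lemma Bessel_inequality:
  fixes f :: "'i \<Rightarrow> 'a::real_inner"
  assumes "finite I" "\<And>i j. i \<in> I \<Longrightarrow> j \<in> I \<Longrightarrow> f i \<bullet> f j = (if i = j then 1 else 0)"
  shows "(\<Sum>i\<in>I. (x \<bullet> f i)\<^sup>2) \<le> (norm x)\<^sup>2"
proof -
  define y where "y = (\<Sum>i\<in>I. (x \<bullet> f i) *\<^sub>R f i)"
  have xy: "x \<bullet> y = (\<Sum>i\<in>I. (x \<bullet> f i)\<^sup>2)"
    by (simp add: y_def inner_sum_right power2_eq_square)
  have "f i \<bullet> y = x \<bullet> f i" if "i \<in> I" for i
  proof -
    have "f i \<bullet> y = (\<Sum>j\<in>I. if i = j then x \<bullet> f i else 0)"
      unfolding y_def inner_sum_right using that assms(2) by (intro sum.cong) auto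
    then show ?thesis
      using that assms(1) by simp
  qed
  then have "y \<bullet> y = (\<Sum>i\<in>I. (x \<bullet> f i)\<^sup>2)"
    unfolding y_def inner_sum_left by (simp add: power2_eq_square flip: y_def)
  then have "(x - y) \<bullet> (x - y) = (norm x)\<^sup>2 - (\<Sum>i\<in>I. (x \<bullet> f i)\<^sup>2)"
    using xy by (simp add: inner_diff_left inner_diff_right inner_commute[of y x] power2_norm_eq_inner)
  then show ?thesis
    by (metis diff_ge_0_iff_ge inner_ge_zero)
qed

lemma norm_sum_orthonormal_square:
  fixes f :: "'i \<Rightarrow> 'a::real_inner"
  assumes "finite I" "\<And>i j. i \<in> I \<Longrightarrow> j \<in> I \<Longrightarrow> f i \<bullet> f j = (if i = j then 1 else 0)"
  shows "(norm (\<Sum>i\<in>I. c i *\<^sub>R f i))\<^sup>2 = (\<Sum>i\<in>I. (c i)\<^sup>2)"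
proof -
  have "f i \<bullet> (\<Sum>j\<in>I. c j *\<^sub>R f j) = c i" if "i \<in> I" for i
  proof -
    have "f i \<bullet> (\<Sum>j\<in>I. c j *\<^sub>R f j) = (\<Sum>j\<in>I. if i = j then c i else 0)"
      unfolding inner_sum_right using that assms(2) by (intro sum.cong) auto
    then show ?thesis
      using that assms(1) by simp
  qed
  then show ?thesis
    by (simp add: power2_norm_eq_inner inner_sum_left) (simp add: power2_eq_square)
qed

text \<open>The threshold \<open>b\<close>, the smallest of the leading values, prices the weights:
  weight withheld from an index below \<open>r\<close> loses at least \<open>b\<close> per unit,
  weight given to an index from \<open>r\<close> on gains at most \<open>b\<close> per unit, and the
  total is at most \<open>r\<close>. This is the scalar core of the Ky Fan principle.\<close>

lemma weighted_sum_le_leading_sum: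
  fixes a w :: "nat \<Rightarrow> real"
  assumes r: "0 < r" "r \<le> p"
    and a: "\<And>k. k < p \<Longrightarrow> 0 \<le> a k" "\<And>i j. i \<le> j \<Longrightarrow> j < p \<Longrightarrow> a j \<le> a i"
    and w: "\<And>k. k < p \<Longrightarrow> 0 \<le> w k" "\<And>k. k < p \<Longrightarrow> w k \<le> 1" "(\<Sum>k<p. w k) \<le> real r"
  shows "(\<Sum>k<p. a k * w k) \<le> (\<Sum>k<r. a k)"
proof -
  define b where "b = a (r - 1)"
  have split: "(\<Sum>k<p. f k) = (\<Sum>k<r. f k) + (\<Sum>k=r..<p. f k)" for f :: "nat \<Rightarrow> real"
    using r by (metis sum.atLeastLessThan_concat lessThan_atLeast0 le0)
  have "(\<Sum>k<r. a k * w k) \<le> (\<Sum>k<r. a k + b * (w k - 1))"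
  proof (rule sum_mono)
    fix k assume k: "k \<in> {..<r}"
    then have "0 \<le> (a k - b) * (1 - w k)"
      using r a(2)[of k "r - 1"] w(2)[of k] by (intro mult_nonneg_nonneg) (auto simp: b_def)
    then show "a k * w k \<le> a k + b * (w k - 1)"
      by (simp add: algebra_simps)
  qed
  moreover have "(\<Sum>k=r..<p. a k * w k) \<le> (\<Sum>k=r..<p. b * w k)"
    using a(2)[of "r - 1"] w(1) r by (intro sum_mono mult_right_mono) (auto simp: b_def)
  ultimately have "(\<Sum>k<p. a k * w k) \<le> (\<Sum>k<r. a k) + b * ((\<Sum>k<p. w k) - real r)"
    by (simp add: split[of w] split[of "\<lambda>k. a k * w k"] sum.distrib sum_distrib_left
        sum_subtractf algebra_simps)
  moreover have "b * ((\<Sum>k<p. w k) - real r) \<le> 0"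
    using a(1)[of "r - 1"] r w(3) by (intro mult_nonneg_nonpos) (auto simp: b_def)
  ultimately show ?thesis
    by simp
qed

section \<open>Singular value decompositions and the Ky Fan maximum principle\<close>

lemma svdD:
  assumes "svd (X :: real^'n2^'n1) \<sigma> u v"
  defines "p \<equiv> min CARD('n1) CARD('n2)"
  shows "\<And>i j. i < p \<Longrightarrow> j < p \<Longrightarrow> u i \<bullet> u j = (if i = j then 1 else 0)"
    and "\<And>i j. i < p \<Longrightarrow> j < p \<Longrightarrow> v i \<bullet> v j = (if i = j then 1 else 0)"
    and "\<And>i. i < p \<Longrightarrow> 0 \<le> \<sigma> i"
    and "\<And>i j. i \<le> j \<Longrightarrow> j < p \<Longrightarrow> \<sigma> j \<le> \<sigma> i"
    and "X = (\<Sum>k<p. \<sigma> k *\<^sub>R (\<chi> i j. u k $ i * v k $ j))"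
  using assms unfolding svd_def Let_def p_def by blast+

lemma svd_transpose: "svd X \<sigma> u v \<Longrightarrow> svd (transpose X) \<sigma> v u"
  unfolding svd_def Let_def
  by (auto simp: min.commute transpose_def vec_eq_iff sum_component mult.commute intro!: sum.cong)

lemma truncated_svd_transpose:
  fixes U :: "real^'r^'n1"
  assumes "truncated_svd X U s V"
  shows "truncated_svd (transpose X) V s U"
  using assms unfolding truncated_svd_def by (metis min.commute svd_transpose)

lemma inner_column_orthonormal:
  "transpose U ** U = mat 1 \<longleftrightarrow> (\<forall>k l. column k U \<bullet> column l U = (if k = l then 1 else 0))"
  for U :: "real^'r^'n"
  by (simp add: matrix_mult_transpose_dot_column vec_eq_iff mat_def)

lemma truncated_svd_orthonormal:
  fixes U :: "real^'r^'n1" and V :: "real^'r^'n2"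
  assumes "truncated_svd X U s V"
  shows "transpose U ** U = mat 1" "transpose V ** V = mat 1"
proof -
  \<comment> \<open>Stated for arbitrary dimensions, so that it applies again to the transposed
    matrix, where \<open>V\<close> takes the role of \<open>U\<close>.\<close>
  have *: "transpose U ** U = mat 1" if "truncated_svd X U s V"
    for X :: "real^'b^'a" and U :: "real^'r^'a" and V :: "real^'r^'b"
  proof -
    obtain \<sigma> u v and \<phi> :: "'r \<Rightarrow> nat" where svd: "svd X \<sigma> u v" and \<phi>: "bij_betw \<phi> UNIV {..<CARD('r)}"
      and U: "U = (\<chi> i k. u (\<phi> k) $ i)" and le: "CARD('r) \<le> min CARD('a) CARD('b)"
      using \<open>truncated_svd X U s V\<close> unfolding truncated_svd_def by blast
    have "column k U = u (\<phi> k)" for k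
      by (simp add: U column_def)
    moreover have "\<phi> k < min CARD('a) CARD('b)" for k
      using le bij_betwE[OF \<phi>] by (meson UNIV_I lessThan_iff less_le_trans)
    moreover have "\<phi> k = \<phi> l \<longleftrightarrow> k = l" for k l
      using \<phi> by (auto simp: bij_betw_def inj_on_def)
    ultimately show ?thesis
      using svdD(1)[OF svd] by (simp add: inner_column_orthonormal)
  qed
  show "transpose U ** U = mat 1" "transpose V ** V = mat 1"
    using *[OF assms] *[OF truncated_svd_transpose[OF assms]] by auto
qed

text \<open>Exchanging the sum over matrix rows with the sum over singular triplets expands each row
  in the orthonormal right singular vectors, from which its norm can be read off.\<close>

lemma row_transpose_mult_svd:
  fixes Q :: "real^'k^'n1" and X :: "real^'n2^'n1"
  assumes "svd X \<sigma> u v"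
  shows "(transpose Q ** X) $ j =
    (\<Sum>k<min CARD('n1) CARD('n2). (\<sigma> k * (column j Q \<bullet> u k)) *\<^sub>R v k)"
proof -
  have "(transpose Q ** X) $ j $ l =
      (\<Sum>i\<in>UNIV. \<Sum>k<min CARD('n1) CARD('n2). Q $ i $ j * (\<sigma> k * (u k $ i * v k $ l)))" for l
    by (subst svdD(5)[OF assms])
      (simp add: matrix_matrix_mult_def transpose_def sum_component sum_distrib_left)
  also have "\<dots> l = (\<Sum>k<min CARD('n1) CARD('n2). \<Sum>i\<in>UNIV. Q $ i $ j * (\<sigma> k * (u k $ i * v k $ l)))" for l
    by (rule sum.swap)
  also have "\<dots> l = (\<Sum>k<min CARD('n1) CARD('n2). (\<sigma> k * (column j Q \<bullet> u k)) *\<^sub>R v k) $ l" for l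
    by (simp add: sum_component column_def inner_vec_def sum_distrib_left sum_distrib_right mult_ac)
  finally show ?thesis
    by (simp add: vec_eq_iff)
qed

text \<open>The right singular vectors are orthonormal, so Pythagoras holds in each row. For
  orthonormal columns of \<open>Q\<close> the inner sum is the squared length of the projection of
  \<open>u k\<close> onto their span, the weight given to the \<open>k\<close>-th squared singular
  value.\<close>

lemma norm_transpose_mult_svd:
  fixes Q :: "real^'k^'n1" and X :: "real^'n2^'n1"
  assumes "svd X \<sigma> u v"
  shows "(norm (transpose Q ** X))\<^sup>2 =
    (\<Sum>k<min CARD('n1) CARD('n2). (\<sigma> k)\<^sup>2 * (\<Sum>j\<in>UNIV. (column j Q \<bullet> u k)\<^sup>2))"
proof -
  let ?p = "min CARD('n1) CARD('n2)"
  have "(norm (transpose Q ** X))\<^sup>2 = (\<Sum>j\<in>UNIV. \<Sum>k<?p. (\<sigma> k * (column j Q \<bullet> u k))\<^sup>2)"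
    unfolding norm_vec_square[of "transpose Q ** X"] row_transpose_mult_svd[OF assms]
    by (intro sum.cong refl norm_sum_orthonormal_square) (simp_all add: svdD(2)[OF assms])
  also have "\<dots> = (\<Sum>k<?p. \<Sum>j\<in>UNIV. (\<sigma> k * (column j Q \<bullet> u k))\<^sup>2)"
    by (rule sum.swap)
  finally show ?thesis
    by (simp add: power_mult_distrib sum_distrib_left)
qed

text \<open>The left singular vectors are orthonormal, so in each row only the triplet with the
  selected index survives.\<close>

lemma truncated_svd_transpose_mult:
  fixes U :: "real^'r^'n1" and V :: "real^'r^'n2"
  assumes "truncated_svd X U s V"
  shows "transpose U ** X = diag s ** transpose V"
proof -
  obtain \<sigma> u v and \<phi> :: "'r \<Rightarrow> nat" where svd: "svd X \<sigma> u v" and \<phi>: "bij_betw \<phi> UNIV {..<CARD('r)}"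
    and U: "U = (\<chi> i k. u (\<phi> k) $ i)" and s: "s = (\<chi> k. \<sigma> (\<phi> k))" and V: "V = (\<chi> j k. v (\<phi> k) $ j)"
    and le: "CARD('r) \<le> min CARD('n1) CARD('n2)"
    using assms unfolding truncated_svd_def by blast
  let ?p = "min CARD('n1) CARD('n2)"
  have "(transpose U ** X) $ j = \<sigma> (\<phi> j) *\<^sub>R v (\<phi> j)" for j
  proof -
    have "\<phi> j < ?p"
      using le bij_betwE[OF \<phi>] by (meson UNIV_I lessThan_iff less_le_trans)
    have "(transpose U ** X) $ j = (\<Sum>k<?p. (\<sigma> k * (u (\<phi> j) \<bullet> u k)) *\<^sub>R v k)"
      unfolding row_transpose_mult_svd[OF svd] by (simp add: U column_def)
    also have "\<dots> = (\<Sum>k<?p. if \<phi> j = k then \<sigma> (\<phi> j) *\<^sub>R v (\<phi> j) else 0)"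
      using \<open>\<phi> j < ?p\<close> svdD(1)[OF svd] by (intro sum.cong) auto
    finally show ?thesis
      using \<open>\<phi> j < ?p\<close> by simp
  qed
  then show ?thesis
    by (simp add: vec_eq_iff diag_mult_nth s V transpose_def)
qed

text \<open>Ky Fan maximum principle: the square of the left side is a weighted sum of squared
  singular values, with weights at most 1 and total at most \<open>CARD('r)\<close>, while
  \<open>U\<close> puts weight 1 on exactly the leading ones.\<close>

lemma norm_transpose_mult_le_truncated_svd:
  fixes U Q :: "real^'r^'n1" and V :: "real^'r^'n2"
  assumes t: "truncated_svd X U s V" and Q: "transpose Q ** Q = mat 1"
  shows "norm (transpose Q ** X) \<le> norm (transpose U ** X)"
proof -
  obtain \<sigma> u v and \<phi> :: "'r \<Rightarrow> nat" where svd: "svd X \<sigma> u v" and \<phi>: "bij_betw \<phi> UNIV {..<CARD('r)}"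
    and s: "s = (\<chi> k. \<sigma> (\<phi> k))" and le: "CARD('r) \<le> min CARD('n1) CARD('n2)"
    using t unfolding truncated_svd_def by blast
  let ?p = "min CARD('n1) CARD('n2)"
  define w where "w k = (\<Sum>j\<in>UNIV. (column j Q \<bullet> u k)\<^sup>2)" for k
  \<comment> \<open>Bessel with the columns of \<open>Q\<close> as the orthonormal system, tested on
    the unit vector \<open>u k\<close>.\<close>
  have "w k \<le> 1" if "k < ?p" for k
    using Bessel_inequality[of UNIV "\<lambda>j. column j Q" "u k"] Q svdD(1)[OF svd that that]
    by (simp add: inner_column_orthonormal w_def inner_commute power2_norm_eq_inner)
  \<comment> \<open>Bessel with the roles exchanged: the vectors \<open>u k\<close> form the system,
    tested on each of the \<open>CARD('r)\<close> unit columns of \<open>Q\<close>.\<close>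
  moreover have "(\<Sum>k<?p. w k) \<le> real CARD('r)"
  proof -
    have "(\<Sum>k<?p. w k) = (\<Sum>j\<in>UNIV. \<Sum>k<?p. (column j Q \<bullet> u k)\<^sup>2)"
      unfolding w_def by (rule sum.swap)
    also have "\<dots> \<le> (\<Sum>j\<in>UNIV. (norm (column j Q))\<^sup>2)"
      by (intro sum_mono Bessel_inequality) (simp_all add: svdD(1)[OF svd])
    also have "\<dots> = real CARD('r)"
      using Q by (simp add: inner_column_orthonormal power2_norm_eq_inner)
    finally show ?thesis .
  qed
  moreover have "(\<sigma> j)\<^sup>2 \<le> (\<sigma> i)\<^sup>2" if "i \<le> j" "j < ?p" for i j
    using svdD(3,4)[OF svd] that by (intro power_mono) auto
  ultimately have "(\<Sum>k<?p. (\<sigma> k)\<^sup>2 * w k) \<le> (\<Sum>k<CARD('r). (\<sigma> k)\<^sup>2)"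
    using le by (intro weighted_sum_le_leading_sum) (auto simp: w_def sum_nonneg)
  moreover have "(\<Sum>k<?p. (\<sigma> k)\<^sup>2 * w k) = (norm (transpose Q ** X))\<^sup>2"
    unfolding norm_transpose_mult_svd[OF svd] w_def ..
  \<comment> \<open>\<open>U\<close> attains the bound, because \<open>transpose U ** X\<close> is
    \<open>diag s ** transpose V\<close>.\<close>
  moreover have "(\<Sum>k<CARD('r). (\<sigma> k)\<^sup>2) = (norm (transpose U ** X))\<^sup>2"
  proof -
    have "(\<Sum>k<CARD('r). (\<sigma> k)\<^sup>2) = (\<Sum>k\<in>UNIV. (s $ k)\<^sup>2)"
      using sum.reindex_bij_betw[OF \<phi>, of "\<lambda>k. (\<sigma> k)\<^sup>2"] by (simp add: s)
    also have "\<dots> = (norm (diag s))\<^sup>2"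
      by (simp add: norm_matrix_square diag_def if_distrib[where f = "\<lambda>x. x\<^sup>2"] cong: if_cong)
    also have "\<dots> = (norm (transpose U ** X))\<^sup>2"
      using truncated_svd_orthonormal(2)[OF t]
      by (simp add: truncated_svd_transpose_mult[OF t] norm_mult_orthonormal_transpose)
    finally show ?thesis .
  qed
  ultimately have "(norm (transpose Q ** X))\<^sup>2 \<le> (norm (transpose U ** X))\<^sup>2"
    by simp
  then show ?thesis
    by (rule power2_le_imp_le) simp
qed

text \<open>By Pythagoras, the Ky Fan principle says that \<open>range_perp U\<close> leaves no more
  of \<open>W\<close> than \<open>range_perp Us\<close> does. Since \<open>range_perp Us\<close>
  annihilates \<open>Xs\<close>, this remainder is at most the norm of \<open>W - Xs\<close>.
  Returning from \<open>W\<close> to \<open>Xs\<close> costs the same amount once more, hence the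
  factor 2.\<close>

lemma norm_range_perp_mult_le_truncated_svd:
  fixes U Us :: "real^'r^'n1"
  assumes t: "truncated_svd W U s V" and c: "compact_svd Xs Us ss Vs"
  shows "norm (range_perp U ** Xs) \<le> 2 * norm (W - Xs)"
proof -
  have U: "transpose U ** U = mat 1" and Us: "transpose Us ** Us = mat 1"
    using truncated_svd_orthonormal(1)[OF t] c by (auto simp: compact_svd_def)
  have "(norm (range_perp U ** W))\<^sup>2 \<le> (norm (range_perp Us ** W))\<^sup>2"
    using norm_transpose_mult_le_truncated_svd[OF t Us]
    by (simp add: norm_range_perp_mult_square[OF U] norm_range_perp_mult_square[OF Us])
  then have "norm (range_perp U ** W) \<le> norm (range_perp Us ** W)"
    by simp
  also have "range_perp Us ** W = range_perp Us ** (W - Xs)"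
    using c range_perp_mult_self[OF Us]
    by (simp add: matrix_diff_ldistrib compact_svd_def matrix_mul_assoc)
  also have "norm \<dots> \<le> norm (W - Xs)"
    using Us by (rule norm_range_perp_mult_le)
  finally have "norm (range_perp U ** W) \<le> norm (W - Xs)" .
  moreover have "norm (range_perp U ** Xs)
      \<le> norm (range_perp U ** W) + norm (range_perp U ** (W - Xs))"
    using norm_triangle_ineq4[of "range_perp U ** W" "range_perp U ** (W - Xs)"]
    by (simp add: matrix_diff_ldistrib)
  moreover have "norm (range_perp U ** (W - Xs)) \<le> norm (W - Xs)"
    using U by (rule norm_range_perp_mult_le)
  ultimately show ?thesis
    by simp
qed

section \<open>Perturbation of the singular factors\<close>

text \<open>Two pairs of factors occur below, those of the current iterate and those of the
  truncated decomposition after the step. The perturbation bounds see either pair only through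
  orthonormality and the amount \<open>d\<close> of \<open>X\<close> that it misses.\<close>

definition approx_factors :: "real^'n2^'n1 \<Rightarrow> real \<Rightarrow> real^'r^'n1 \<Rightarrow> real^'r^'n2 \<Rightarrow> bool" where
  "approx_factors X d U V \<longleftrightarrow> transpose U ** U = mat 1 \<and> transpose V ** V = mat 1 \<and>
     norm (range_perp U ** X) \<le> d \<and> norm (X ** range_perp V) \<le> d"

lemma approx_factors_transpose: "approx_factors X d U V \<Longrightarrow> approx_factors (transpose X) d V U"
  using norm_transpose[of "range_perp U ** X"] norm_transpose[of "X ** range_perp V"]
  by (simp add: approx_factors_def matrix_transpose_mul)

lemma approx_factors_truncated_svd:
  fixes U Us :: "real^'r^'n1" and V Vs :: "real^'r^'n2"
  assumes t: "truncated_svd W U s V" and c: "compact_svd Xs Us ss Vs"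
  shows "approx_factors Xs (2 * norm (W - Xs)) U V"
proof -
  have "norm (Xs ** range_perp V) = norm (range_perp V ** transpose Xs)"
    using norm_transpose[of "Xs ** range_perp V"] by (simp add: matrix_transpose_mul)
  also have "\<dots> \<le> 2 * norm (transpose W - transpose Xs)"
    using truncated_svd_transpose[OF t] compact_svd_transpose[OF c]
    by (rule norm_range_perp_mult_le_truncated_svd)
  also have "norm (transpose W - transpose Xs) = norm (W - Xs)"
    by (metis norm_transpose transpose_diff)
  finally show ?thesis
    using truncated_svd_orthonormal[OF t] norm_range_perp_mult_le_truncated_svd[OF t c]
    by (simp add: approx_factors_def)
qed

lemma approx_factors_mono: "approx_factors X d U V \<Longrightarrow> d \<le> d' \<Longrightarrow> approx_factors X d' U V"
  by (auto simp: approx_factors_def)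

lemma compact_svd_min_entry_pos: "compact_svd X U s V \<Longrightarrow> 0 < min_entry s"
  by (simp add: compact_svd_def min_entry_pos)

text \<open>Right multiplication by \<open>transpose Vs\<close> preserves the norm and
  \<open>diag ss\<close> stretches every column by at least \<open>min_entry ss\<close>, so the part
  of \<open>Xs\<close> missed by \<open>U\<close> controls the sine matrix between \<open>U\<close>
  and \<open>Us\<close>. Here the division by the smallest singular value enters.\<close>

lemma approx_factors_norm_range_perp_mult_le:
  fixes U Us :: "real^'r^'n1" and V Vs :: "real^'r^'n2"
  assumes a: "approx_factors Xs d U V" and c: "compact_svd Xs Us ss Vs"
  shows "min_entry ss * norm (range_perp U ** Us) \<le> d"
proof -
  have "min_entry ss * norm (range_perp U ** Us) \<le> norm (range_perp U ** Us ** diag ss)"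
    using compact_svd_min_entry_pos[OF c] by (intro min_entry_norm_le_norm_mult_diag) simp
  also have "\<dots> = norm (range_perp U ** Xs)"
    using c norm_mult_orthonormal_transpose[of Vs "range_perp U ** Us ** diag ss"]
    by (simp add: compact_svd_def matrix_mul_assoc)
  finally show ?thesis
    using a by (simp add: approx_factors_def)
qed

text \<open>Splitting \<open>W\<close> as \<open>Xs\<close> plus the error and exchanging one
  projection at a time leaves three terms, each with two small factors: in \<open>T1\<close> the
  matrix \<open>Xs\<close> is nearly annihilated from both sides, in \<open>T2\<close> and
  \<open>T3\<close> the error of one projection meets \<open>W - Xs\<close>.\<close>

lemma norm_perp_perp_diff_le:
  fixes U Us :: "real^'r^'n1" and V Vs :: "real^'r^'n2"
  assumes a: "approx_factors Xs d U V" and c: "compact_svd Xs Us ss Vs"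
    and W: "norm (W - Xs) \<le> \<epsilon>"
  shows "min_entry ss * norm (range_perp U ** W ** range_perp V
           - range_perp Us ** (W - Xs) ** range_perp Vs) \<le> d\<^sup>2 + 4 * d * \<epsilon>"
proof -
  let ?\<sigma> = "min_entry ss" and ?E = "W - Xs"
  have U: "transpose U ** U = mat 1" and Us: "transpose Us ** Us = mat 1"
    and V: "transpose V ** V = mat 1" and Vs: "transpose Vs ** Vs = mat 1"
    using a c by (auto simp: compact_svd_def approx_factors_def)
  have \<sigma>: "0 < ?\<sigma>"
    using c by (rule compact_svd_min_entry_pos)
  have dU: "?\<sigma> * norm (range_perp U ** Us) \<le> d"
    using a c by (rule approx_factors_norm_range_perp_mult_le)
  have dV: "?\<sigma> * norm (range_perp V ** Vs) \<le> d"
    using approx_factors_transpose[OF a] compact_svd_transpose[OF c]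
    by (rule approx_factors_norm_range_perp_mult_le)
  have d: "0 \<le> d"
    using a norm_ge_zero order_trans unfolding approx_factors_def by blast
  have \<epsilon>: "0 \<le> \<epsilon>"
    using W norm_ge_zero order_trans by blast
  define T1 where "T1 = range_perp U ** Xs ** range_perp V"
  define T2 where "T2 = (range_perp U - range_perp Us) ** ?E ** range_perp V"
  define T3 where "T3 = range_perp Us ** (?E ** (range_perp V - range_perp Vs))"
  have eq: "range_perp U ** W ** range_perp V - range_perp Us ** ?E ** range_perp Vs = T1 + T2 + T3"
    by (simp add: T1_def T2_def T3_def matrix_distribs matrix_mul_assoc)
  have "?\<sigma> * norm T1 \<le> d * d"
  proof -
    \<comment> \<open>Inserting \<open>Xs = Xs ** range_proj Vs\<close> brings out the second small
      factor, \<open>range_proj Vs ** range_perp V\<close>.\<close>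
    have "T1 = range_perp U ** Xs ** (range_proj Vs ** range_perp V)"
      using c Vs unfolding T1_def
      by (simp add: compact_svd_def range_proj_def matrix_mul_assoc)
        (simp flip: matrix_mul_assoc)
    then have "norm T1 \<le> norm (range_perp U ** Xs) * norm (range_perp V ** Vs)"
      by (metis norm_matrix_mult_le norm_range_proj_mult_range_perp[OF Vs])
    then have "?\<sigma> * norm T1 \<le> norm (range_perp U ** Xs) * (?\<sigma> * norm (range_perp V ** Vs))"
      using \<sigma> by (simp add: mult.left_commute)
    also have "\<dots> \<le> d * d"
      using a dV \<sigma> d by (intro mult_mono) (auto simp: approx_factors_def)
    finally show ?thesis .
  qed
  moreover have "?\<sigma> * norm T2 \<le> 2 * d * \<epsilon>"
  proof -
    have "norm T2 \<le> norm (range_perp U - range_perp Us) * norm ?E"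
      unfolding T2_def by (rule order_trans[OF norm_mult_range_perp_le[OF V] norm_matrix_mult_le])
    then have "?\<sigma> * norm T2 \<le> (?\<sigma> * norm (range_perp U - range_perp Us)) * norm ?E"
      using \<sigma> by (simp add: mult.assoc)
    also have "\<dots> \<le> (2 * d) * \<epsilon>"
    proof (rule mult_mono)
      have "?\<sigma> * norm (range_perp U - range_perp Us) \<le> ?\<sigma> * (2 * norm (range_perp U ** Us))"
        using norm_range_perp_diff_le[OF U Us] \<sigma> by simp
      then show "?\<sigma> * norm (range_perp U - range_perp Us) \<le> 2 * d"
        using dU by simp
    qed (use d W in auto)
    finally show ?thesis by simp
  qed
  moreover have "?\<sigma> * norm T3 \<le> 2 * d * \<epsilon>"
  proof -
    have "norm T3 \<le> norm ?E * norm (range_perp V - range_perp Vs)"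
      unfolding T3_def by (rule order_trans[OF norm_range_perp_mult_le[OF Us] norm_matrix_mult_le])
    then have "?\<sigma> * norm T3 \<le> norm ?E * (?\<sigma> * norm (range_perp V - range_perp Vs))"
      using \<sigma> by (simp add: mult.left_commute)
    also have "\<dots> \<le> \<epsilon> * (2 * d)"
    proof (rule mult_mono)
      have "?\<sigma> * norm (range_perp V - range_perp Vs) \<le> ?\<sigma> * (2 * norm (range_perp V ** Vs))"
        using norm_range_perp_diff_le[OF V Vs] \<sigma> by simp
      then show "?\<sigma> * norm (range_perp V - range_perp Vs) \<le> 2 * d"
        using dV by simp
    qed (use \<epsilon> \<sigma> W in auto)
    finally show ?thesis by (simp add: mult_ac)
  qed
  moreover have "?\<sigma> * norm (T1 + T2 + T3) \<le> ?\<sigma> * norm T1 + ?\<sigma> * norm T2 + ?\<sigma> * norm T3"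
    using norm_triangle_ineq[of "T1 + T2" T3] norm_triangle_ineq[of T1 T2] \<sigma>
    by (simp flip: distrib_left)
  ultimately show ?thesis
    unfolding eq by (simp add: power2_eq_square)
qed

text \<open>\<open>D\<close> is normal with respect to \<open>U\<close>, \<open>V\<close>, and the
  difference is its tangential part with respect to \<open>Us\<close>, \<open>Vs\<close>. In both
  terms of that part a projection meets the complement of a nearby one. The bound serves for the
  part of the gradient that the Riemannian gradient drops.\<close>

lemma norm_normal_diff_le:
  fixes U Us :: "real^'r^'n1" and V Vs :: "real^'r^'n2" and Z :: "real^'n2^'n1"
  assumes a: "approx_factors Xs d U V" and c: "compact_svd Xs Us ss Vs"
  defines "D \<equiv> range_perp U ** Z ** range_perp V"
  shows "min_entry ss * norm (D - range_perp Us ** D ** range_perp Vs) \<le> 2 * d * norm Z"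
proof -
  let ?\<sigma> = "min_entry ss"
  have U: "transpose U ** U = mat 1" and Us: "transpose Us ** Us = mat 1"
    and V: "transpose V ** V = mat 1" and Vs: "transpose Vs ** Vs = mat 1"
    using a c by (auto simp: compact_svd_def approx_factors_def)
  have \<sigma>: "0 < ?\<sigma>"
    using c by (rule compact_svd_min_entry_pos)
  have dU: "?\<sigma> * norm (range_perp U ** Us) \<le> d"
    using a c by (rule approx_factors_norm_range_perp_mult_le)
  have dV: "?\<sigma> * norm (range_perp V ** Vs) \<le> d"
    using approx_factors_transpose[OF a] compact_svd_transpose[OF c]
    by (rule approx_factors_norm_range_perp_mult_le)
  have "D - range_perp Us ** D ** range_perp Vs = range_proj Us ** D + range_perp Us ** (D ** range_proj Vs)"
    by (simp add: range_perp_def matrix_distribs matrix_mul_assoc)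
  moreover have "norm (range_proj Us ** D) \<le> norm (range_perp U ** Us) * norm Z"
  proof -
    have "norm (range_proj Us ** D) \<le> norm (range_proj Us ** range_perp U ** Z)"
      unfolding D_def matrix_mul_assoc using V by (rule norm_mult_range_perp_le)
    also have "\<dots> \<le> norm (range_proj Us ** range_perp U) * norm Z"
      by (rule norm_matrix_mult_le)
    finally show ?thesis
      by (simp add: norm_range_proj_mult_range_perp[OF Us])
  qed
  moreover have "norm (range_perp Us ** (D ** range_proj Vs)) \<le> norm Z * norm (range_perp V ** Vs)"
  proof -
    have "norm (range_perp Us ** (D ** range_proj Vs)) \<le> norm (D ** range_proj Vs)"
      using Us by (rule norm_range_perp_mult_le)
    also have "\<dots> = norm (range_perp U ** (Z ** (range_perp V ** range_proj Vs)))"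
      by (simp add: D_def matrix_mul_assoc)
    also have "\<dots> \<le> norm (Z ** (range_perp V ** range_proj Vs))"
      using U by (rule norm_range_perp_mult_le)
    also have "\<dots> \<le> norm Z * norm (range_perp V ** range_proj Vs)"
      by (rule norm_matrix_mult_le)
    finally show ?thesis
      by (simp add: norm_range_perp_mult_range_proj[OF Vs])
  qed
  ultimately have "norm (D - range_perp Us ** D ** range_perp Vs)
      \<le> norm (range_perp U ** Us) * norm Z + norm Z * norm (range_perp V ** Vs)"
    by (simp only: norm_triangle_le add_mono)
  then have "?\<sigma> * norm (D - range_perp Us ** D ** range_perp Vs)
      \<le> ?\<sigma> * (norm (range_perp U ** Us) * norm Z + norm Z * norm (range_perp V ** Vs))"
    using \<sigma> by (intro mult_left_mono) auto
  also have "\<dots> = (?\<sigma> * norm (range_perp U ** Us)) * norm Z + (?\<sigma> * norm (range_perp V ** Vs)) * norm Z"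
    by (simp add: algebra_simps)
  also have "\<dots> \<le> d * norm Z + d * norm Z"
    by (intro add_mono mult_right_mono dU dV norm_ge_zero)
  finally show ?thesis
    by simp
qed

section \<open>The two retractions as projections up to second order\<close>

text \<open>\<open>range_proj U ** W\<close>, \<open>W ** range_proj V\<close> and
  \<open>range_proj U ** W ** range_proj V\<close> all equal the truncated matrix, so expanding the
  right side leaves one copy of it.\<close>

lemma truncated_svd_eq_minus_perp:
  fixes U :: "real^'r^'n1" and V :: "real^'r^'n2"
  assumes t: "truncated_svd W U s V"
  shows "U ** diag s ** transpose V = W - range_perp U ** W ** range_perp V"
proof -
  have U: "range_proj U ** W = U ** diag s ** transpose V"
    using truncated_svd_transpose_mult[OF t] by (simp add: range_proj_def flip: matrix_mul_assoc)
  have "W ** V = transpose (transpose V ** transpose W)"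
    by (simp add: matrix_transpose_mul)
  also have "\<dots> = U ** diag s"
    using truncated_svd_transpose_mult[OF truncated_svd_transpose[OF t]]
    by (simp add: matrix_transpose_mul)
  finally have V: "W ** range_proj V = U ** diag s ** transpose V"
    by (simp add: range_proj_def matrix_mul_assoc)
  have "U ** diag s ** transpose V ** range_proj V = U ** diag s ** transpose V"
    using range_proj_idem[OF truncated_svd_orthonormal(2)[OF t]] unfolding V[symmetric]
    by (simp flip: matrix_mul_assoc)
  then show ?thesis
    by (simp add: range_perp_mult mult_range_perp matrix_distribs U V)
qed

lemma matrix_inv_inverse:
  fixes A :: "real^'n^'n"
  assumes "\<And>x. A *v x = 0 \<Longrightarrow> x = 0"
  shows "A ** matrix_inv A = mat 1" "matrix_inv A ** A = mat 1"
proof -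
  have "invertible A"
    using assms by (simp add: invertible_left_inverse matrix_left_invertible_ker)
  then have "\<exists>B. A ** B = mat 1 \<and> B ** A = mat 1"
    by (simp add: invertible_def)
  then show "A ** matrix_inv A = mat 1" "matrix_inv A ** A = mat 1"
    unfolding matrix_inv_def by (metis (mono_tags, lifting) someI_ex)+
qed

text \<open>From the smallest singular value of \<open>Xs\<close>, one \<open>d\<close> is lost by
  keeping only the component of \<open>V ** Y\<close> along \<open>Vs\<close>, another by projecting
  \<open>Xs\<close> with \<open>U\<close>, and \<open>\<epsilon>\<close> by replacing
  \<open>Xs\<close> with \<open>W\<close>. As \<open>Y\<close> is a matrix, the bound serves both
  for the kernel of the core matrix and for its inverse.\<close>

lemma norm_core_mult_ge:
  fixes U Us :: "real^'r^'n1" and V Vs :: "real^'r^'n2" and Y :: "real^'k^'r"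
  assumes a: "approx_factors Xs d U V" and c: "compact_svd Xs Us ss Vs"
    and W: "norm (W - Xs) \<le> \<epsilon>"
  shows "(min_entry ss - 2 * d - \<epsilon>) * norm Y \<le> norm (transpose U ** W ** V ** Y)"
proof -
  let ?\<sigma> = "min_entry ss"
  have U: "transpose U ** U = mat 1" and Us: "transpose Us ** Us = mat 1"
    and V: "transpose V ** V = mat 1" and Vs: "transpose Vs ** Vs = mat 1"
    using a c by (auto simp: compact_svd_def approx_factors_def)
  have \<sigma>: "0 < ?\<sigma>"
    using c by (rule compact_svd_min_entry_pos)
  have dV: "?\<sigma> * norm (range_perp V ** Vs) \<le> d"
    using approx_factors_transpose[OF a] compact_svd_transpose[OF c]
    by (rule approx_factors_norm_range_perp_mult_le)
  have VY: "norm (V ** Y) = norm Y"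
    using V by (rule norm_orthonormal_mult)
  have "V ** Y = range_proj Vs ** (V ** Y) + range_perp Vs ** V ** Y"
    using range_proj_add_range_perp[of Vs "V ** Y"] by (simp add: matrix_mul_assoc)
  then have "norm Y \<le> norm (range_proj Vs ** (V ** Y)) + norm (range_perp Vs ** V ** Y)"
    by (metis VY norm_triangle_ineq)
  also have "\<dots> \<le> norm (transpose Vs ** (V ** Y)) + norm (range_perp V ** Vs) * norm Y"
    using norm_matrix_mult_le[of "range_perp Vs ** V" Y]
    by (simp add: norm_range_proj_mult[OF Vs] norm_range_perp_mult_commute[OF V Vs])
  finally have "?\<sigma> * norm Y \<le> ?\<sigma> * norm (transpose Vs ** (V ** Y)) + (?\<sigma> * norm (range_perp V ** Vs)) * norm Y"
    using \<sigma> by (simp add: mult.assoc flip: distrib_left)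
  also have "\<dots> \<le> norm (diag ss ** (transpose Vs ** (V ** Y))) + d * norm Y"
    using \<sigma> by (intro add_mono min_entry_norm_le_norm_diag_mult mult_right_mono dV) auto
  also have "norm (diag ss ** (transpose Vs ** (V ** Y))) = norm (Xs ** (V ** Y))"
    using c norm_orthonormal_mult[OF Us, of "diag ss ** (transpose Vs ** (V ** Y))"]
    by (simp add: compact_svd_def matrix_mul_assoc)
  also have "Xs ** (V ** Y) = range_proj U ** (W ** V ** Y) + range_perp U ** Xs ** (V ** Y)
      - range_proj U ** ((W - Xs) ** (V ** Y))"
    by (simp add: range_perp_def matrix_distribs matrix_mul_assoc)
  also have "norm \<dots> \<le> norm (transpose U ** W ** V ** Y) + d * norm Y + \<epsilon> * norm Y"
  proof -
    have "norm (range_proj U ** (W ** V ** Y)) = norm (transpose U ** W ** V ** Y)"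
      using norm_range_proj_mult[OF U, of "W ** V ** Y"] by (simp add: matrix_mul_assoc)
    moreover have "norm (range_perp U ** Xs ** (V ** Y)) \<le> d * norm Y"
    proof -
      have "norm (range_perp U ** Xs ** (V ** Y)) \<le> norm (range_perp U ** Xs) * norm Y"
        by (metis VY norm_matrix_mult_le)
      also have "\<dots> \<le> d * norm Y"
        using a by (intro mult_right_mono) (auto simp: approx_factors_def)
      finally show ?thesis .
    qed
    moreover have "norm (range_proj U ** ((W - Xs) ** (V ** Y))) \<le> \<epsilon> * norm Y"
    proof -
      have "norm (range_proj U ** ((W - Xs) ** (V ** Y))) \<le> norm ((W - Xs) ** (V ** Y))"
        by (simp add: norm_range_proj_mult[OF U] norm_orthonormal_transpose_mult_le[OF U])
      also have "\<dots> \<le> norm (W - Xs) * norm Y"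
        by (metis VY norm_matrix_mult_le)
      also have "\<dots> \<le> \<epsilon> * norm Y"
        using W by (intro mult_right_mono) auto
      finally show ?thesis .
    qed
    ultimately show ?thesis
      by (smt (verit) norm_triangle_ineq norm_triangle_ineq4)
  qed
  finally show ?thesis
    by (simp add: algebra_simps)
qed

text \<open>Both \<open>W ** V\<close> and \<open>transpose U ** W\<close> split off the core block
  \<open>A\<close>, which cancels against its inverse in all products but
  \<open>L ** matrix_inv A ** R\<close>. The blocks \<open>L\<close> and \<open>R\<close> are at
  most \<open>d + \<epsilon>\<close>, and the inverse costs a factor
  \<open>2 / min_entry ss\<close>.\<close>

lemma norm_orthographic_diff_le:
  fixes U Us :: "real^'r^'n1" and V Vs :: "real^'r^'n2"
  assumes a: "approx_factors Xs d U V" and c: "compact_svd Xs Us ss Vs"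
    and W: "norm (W - Xs) \<le> \<epsilon>" and small: "2 * d + \<epsilon> \<le> min_entry ss / 2"
  shows "min_entry ss * norm (W ** V ** matrix_inv (transpose U ** W ** V) ** transpose U ** W
           - (W - range_perp U ** W ** range_perp V)) \<le> 2 * (d + \<epsilon>)\<^sup>2"
proof -
  let ?\<sigma> = "min_entry ss"
  define A where "A = transpose U ** W ** V"
  define L where "L = range_perp U ** W ** V"
  define R where "R = transpose U ** W ** range_perp V"
  have U: "transpose U ** U = mat 1" and V: "transpose V ** V = mat 1"
    using a by (auto simp: approx_factors_def)
  have \<sigma>: "0 < ?\<sigma>"
    using c by (rule compact_svd_min_entry_pos)
  have d: "0 \<le> d"
    using a norm_ge_zero order_trans unfolding approx_factors_def by blast
  have \<epsilon>: "0 \<le> \<epsilon>"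
    using W norm_ge_zero order_trans by blast
  \<comment> \<open>The smallness assumption reserves half of the smallest singular value for the
    core block.\<close>
  have half: "?\<sigma> / 2 * norm Y \<le> norm (A ** Y)" for Y :: "real^'k^'r"
  proof -
    have "?\<sigma> / 2 * norm Y \<le> (?\<sigma> - 2 * d - \<epsilon>) * norm Y"
      using small by (intro mult_right_mono) auto
    then show ?thesis
      using norm_core_mult_ge[OF a c W, of Y] by (simp add: A_def)
  qed
  have "x = 0" if "A *v x = 0" for x
  proof -
    \<comment> \<open>A vector is read as a one-column matrix, so that the Frobenius bound shows the
      kernel of \<open>A\<close> to be trivial.\<close>
    define Y :: "real^1^'r" where "Y = (\<chi> i j. x $ i)"
    have "A ** Y = 0"
      using that by (simp add: Y_def matrix_matrix_mult_def matrix_vector_mult_def vec_eq_iff)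
    then have "Y = 0"
      using half[of Y] \<sigma> by (simp add: mult_le_0_iff)
    then show ?thesis
      by (simp add: Y_def vec_eq_iff)
  qed
  note inv = matrix_inv_inverse[of A, OF this]
  have WV: "W ** V = U ** A + L"
    by (simp add: A_def L_def range_perp_def range_proj_def matrix_distribs matrix_mul_assoc)
  have UW: "transpose U ** W = A ** transpose V + R"
    by (simp add: A_def R_def range_perp_def range_proj_def matrix_distribs matrix_mul_assoc)
  have "W ** V ** matrix_inv A ** transpose U ** W = (U ** A + L) ** matrix_inv A ** (A ** transpose V + R)"
    unfolding WV[symmetric] UW[symmetric] by (simp only: matrix_mul_assoc)
  also have "\<dots> = U ** (A ** matrix_inv A) ** A ** transpose V + U ** (A ** matrix_inv A) ** R
      + L ** (matrix_inv A ** A) ** transpose V + L ** matrix_inv A ** R"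
    by (simp add: matrix_distribs matrix_mul_assoc)
  also have "\<dots> = U ** A ** transpose V + U ** R + L ** transpose V + L ** matrix_inv A ** R"
    by (simp add: inv)
  also have "U ** A ** transpose V + U ** R + L ** transpose V = W - range_perp U ** W ** range_perp V"
    by (simp add: A_def L_def R_def range_perp_def range_proj_def matrix_distribs matrix_mul_assoc)
  finally have eq: "W ** V ** matrix_inv A ** transpose U ** W - (W - range_perp U ** W ** range_perp V)
      = L ** (matrix_inv A ** R)"
    by (simp add: matrix_mul_assoc)
  have L: "norm L \<le> d + \<epsilon>"
  proof -
    have "norm L \<le> norm (range_perp U ** W)"
      unfolding L_def using V by (rule norm_mult_orthonormal_le)
    also have "range_perp U ** W = range_perp U ** Xs + range_perp U ** (W - Xs)"
      by (simp add: matrix_distribs)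
    also have "norm \<dots> \<le> norm (range_perp U ** Xs) + norm (range_perp U ** (W - Xs))"
      by (rule norm_triangle_ineq)
    also have "\<dots> \<le> d + \<epsilon>"
      using a W norm_range_perp_mult_le[OF U, of "W - Xs"] by (auto simp: approx_factors_def)
    finally show ?thesis .
  qed
  have R: "norm R \<le> d + \<epsilon>"
  proof -
    have "norm R \<le> norm (W ** range_perp V)"
      unfolding R_def matrix_mul_assoc[symmetric] using U by (rule norm_orthonormal_transpose_mult_le)
    also have "W ** range_perp V = Xs ** range_perp V + (W - Xs) ** range_perp V"
      by (simp add: matrix_distribs)
    also have "norm \<dots> \<le> norm (Xs ** range_perp V) + norm ((W - Xs) ** range_perp V)"
      by (rule norm_triangle_ineq)
    also have "\<dots> \<le> d + \<epsilon>"
      using a W norm_mult_range_perp_le[OF V, of "W - Xs"] by (auto simp: approx_factors_def)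
    finally show ?thesis .
  qed
  \<comment> \<open>The lower bound is applied to \<open>matrix_inv A ** R\<close> itself, which
    \<open>A\<close> maps back to \<open>R\<close>.\<close>
  have "?\<sigma> / 2 * norm (matrix_inv A ** R) \<le> norm R"
    using half[of "matrix_inv A ** R"] by (simp add: matrix_mul_assoc inv)
  then have "?\<sigma> * norm (matrix_inv A ** R) \<le> 2 * (d + \<epsilon>)"
    using R by simp
  then have "norm L * (?\<sigma> * norm (matrix_inv A ** R)) \<le> (d + \<epsilon>) * (2 * (d + \<epsilon>))"
    using L \<sigma> d \<epsilon> by - (rule mult_mono, auto)
  moreover have "?\<sigma> * norm (L ** (matrix_inv A ** R)) \<le> ?\<sigma> * (norm L * norm (matrix_inv A ** R))"
    using \<sigma> by (intro mult_left_mono norm_matrix_mult_le) auto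
  ultimately show ?thesis
    unfolding A_def[symmetric] eq by (simp add: power2_eq_square mult_ac)
qed

section \<open>The gradient bound and the error of one step\<close>

text \<open>The squared norm of \<open>adjoint A z\<close> is
  \<open>A (adjoint A z) \<bullet> z\<close>; Cauchy-Schwarz and cancelling one factor bound the
  adjoint by \<open>onorm A\<close>, and the two bounds compose.\<close>

lemma norm_adjoint_comp_le:
  fixes A :: "'a::euclidean_space \<Rightarrow> 'b::euclidean_space"
  assumes "linear A"
  shows "norm (adjoint A (A x)) \<le> (onorm A)\<^sup>2 * norm x"
proof -
  have A: "bounded_linear A"
    using assms by (simp add: linear_conv_bounded_linear)
  have adj: "norm (adjoint A z) \<le> onorm A * norm z" for z
  proof -
    have "(norm (adjoint A z))\<^sup>2 = A (adjoint A z) \<bullet> z"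
      by (metis adjoint_works[OF assms] power2_norm_eq_inner)
    also have "\<dots> \<le> norm (A (adjoint A z)) * norm z"
      by (rule norm_cauchy_schwarz)
    also have "\<dots> \<le> (onorm A * norm (adjoint A z)) * norm z"
      by (intro mult_right_mono onorm[OF A]) simp
    finally show ?thesis
      using onorm_pos_le[OF A]
      by (cases "norm (adjoint A z) = 0") (auto simp: power2_eq_square mult_ac)
  qed
  have "norm (adjoint A (A x)) \<le> onorm A * (onorm A * norm x)"
    using adj[of "A x"] mult_left_mono[OF onorm[OF A, of x] onorm_pos_le[OF A]] by linarith
  then show ?thesis
    by (simp add: power2_eq_square mult_ac)
qed

text \<open>A common form for both retractions: the result is \<open>X + \<delta>\<close> without
  its normal part for suitable approximate factors, up to second order, and these factors are then
  exchanged for \<open>Us\<close>, \<open>Vs\<close>.\<close>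

lemma retraction_expansion:
  fixes U Us :: "real^'r^'n1" and V Vs :: "real^'r^'n2"
  assumes ret: "retracts R U V X \<delta> Z" and a: "approx_factors Xs d U V"
    and c: "compact_svd Xs Us ss Vs"
    and W: "norm (X + \<delta> - Xs) \<le> \<epsilon>" and d: "d \<le> 2 * \<epsilon>" and small: "2 * d + \<epsilon> \<le> min_entry ss / 2"
  defines "E \<equiv> X + \<delta> - Xs"
  shows "min_entry ss * norm (Z - Xs - (E - range_perp Us ** E ** range_perp Vs)) \<le> 30 * \<epsilon>\<^sup>2"
proof -
  let ?\<sigma> = "min_entry ss" and ?W = "X + \<delta>"
  have \<sigma>: "0 < ?\<sigma>"
    using c by (rule compact_svd_min_entry_pos)
  have \<epsilon>: "0 \<le> \<epsilon>"
    using W norm_ge_zero order_trans by blast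
  \<comment> \<open>For the projective retraction the witnesses are the factors of
    \<open>X + \<delta>\<close> and the defect is zero. For the orthographic one they are the given
    \<open>U\<close>, \<open>V\<close>, and \<open>2 * (d + \<epsilon>)\<^sup>2\<close> with
    \<open>d \<le> 2 * \<epsilon>\<close> gives the 18.\<close>
  obtain U' :: "real^'r^'n1" and V' :: "real^'r^'n2" where a': "approx_factors Xs (2 * \<epsilon>) U' V'"
    and Z: "?\<sigma> * norm (Z - (?W - range_perp U' ** ?W ** range_perp V')) \<le> 18 * \<epsilon>\<^sup>2"
  proof (cases R)
    case Projective
    then obtain U' :: "real^'r^'n1" and s' and V' :: "real^'r^'n2"
      where t: "truncated_svd ?W U' s' V'" and Z: "Z = U' ** diag s' ** transpose V'"
      using ret by auto
    show ?thesis
    proof (rule that)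
      show "approx_factors Xs (2 * \<epsilon>) U' V'"
        using approx_factors_truncated_svd[OF t c] by (rule approx_factors_mono) (use W in simp)
      show "?\<sigma> * norm (Z - (?W - range_perp U' ** ?W ** range_perp V')) \<le> 18 * \<epsilon>\<^sup>2"
        unfolding Z truncated_svd_eq_minus_perp[OF t] by simp
    qed
  next
    case Orthographic
    then have Z: "Z = ?W ** V ** matrix_inv (transpose U ** ?W ** V) ** transpose U ** ?W"
      using ret by simp
    show ?thesis
    proof (rule that)
      show "approx_factors Xs (2 * \<epsilon>) U V"
        using a d by (rule approx_factors_mono)
      have "0 \<le> d"
        using a norm_ge_zero order_trans unfolding approx_factors_def by blast
      then have "(d + \<epsilon>)\<^sup>2 \<le> (3 * \<epsilon>)\<^sup>2"
        using d \<epsilon> by (intro power_mono) auto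
      then show "?\<sigma> * norm (Z - (?W - range_perp U ** ?W ** range_perp V)) \<le> 18 * \<epsilon>\<^sup>2"
        unfolding Z using norm_orthographic_diff_le[OF a c W small] by (simp add: power_mult_distrib)
    qed
  qed
  have "Z - Xs - (E - range_perp Us ** E ** range_perp Vs) =
      (Z - (?W - range_perp U' ** ?W ** range_perp V'))
      - (range_perp U' ** ?W ** range_perp V' - range_perp Us ** E ** range_perp Vs)"
    by (simp add: E_def)
  then have "?\<sigma> * norm (Z - Xs - (E - range_perp Us ** E ** range_perp Vs))
      \<le> ?\<sigma> * (norm (Z - (?W - range_perp U' ** ?W ** range_perp V'))
        + norm (range_perp U' ** ?W ** range_perp V' - range_perp Us ** E ** range_perp Vs))"
    by (simp only:) (rule mult_left_mono[OF norm_triangle_ineq4 less_imp_le[OF \<sigma>]])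
  \<comment> \<open>The further 12 is \<open>d\<^sup>2 + 4 * d * \<epsilon>\<close> at
    \<open>d = 2 * \<epsilon>\<close>.\<close>
  also have "\<dots> \<le> 18 * \<epsilon>\<^sup>2 + ((2 * \<epsilon>)\<^sup>2 + 4 * (2 * \<epsilon>) * \<epsilon>)"
    unfolding distrib_left using Z norm_perp_perp_diff_le[OF a' c W] by (simp only: E_def add_mono)
  finally show ?thesis
    by (simp add: power2_eq_square)
qed

text \<open>The retracted point differs from \<open>Xs\<close> by \<open>H + D\<close>, where
  \<open>H\<close> is the error after a Euclidean gradient step and \<open>D\<close> is the normal
  part that the Riemannian gradient leaves out. To second order the retraction acts as the tangent
  projection at \<open>Xs\<close>, which nearly annihilates \<open>D\<close>.\<close>

lemma rgrad_step_error_le: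
  fixes U Us :: "real^'r^'n1" and V Vs :: "real^'r^'n2" and X :: "real^'n2^'n1"
  assumes A: "linear A" and c: "compact_svd Xs Us ss Vs"
    and a: "approx_factors Xs (2 * norm (X - Xs)) U V"
    and ret: "retracts R U V X (- (\<mu> *\<^sub>R riem_grad A (A Xs) U V X)) Z"
    and \<mu>: "0 \<le> \<mu>" "\<mu> * (onorm A)\<^sup>2 \<le> K" and K: "0 \<le> K"
    and basin: "norm (X - Xs) \<le> 1 / (2 * (5 + 2 * K)) * min_entry ss"
  defines "H \<equiv> X - Xs - \<mu> *\<^sub>R adjoint A (A (X - Xs))"
  shows "min_entry ss * norm (Z - Xs - (H - range_perp Us ** H ** range_perp Vs))
    \<le> (30 * (1 + 2 * K)\<^sup>2 + 4 * K) * (norm (X - Xs))\<^sup>2"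
proof -
  let ?\<sigma> = "min_entry ss" and ?\<eta> = "norm (X - Xs)"
  define g where "g = adjoint A (A (X - Xs))"
  \<comment> \<open>Bounds \<open>H + D\<close>: the current error contributes 1, the gradient step
    and its normal part contribute \<open>K\<close> each.\<close>
  define \<epsilon> where "\<epsilon> = (1 + 2 * K) * ?\<eta>"
  define D where "D = range_perp U ** (\<mu> *\<^sub>R g) ** range_perp V"
  have U: "transpose U ** U = mat 1" and V: "transpose V ** V = mat 1"
    using a by (auto simp: approx_factors_def)
  have \<sigma>: "0 < ?\<sigma>"
    using c by (rule compact_svd_min_entry_pos)
  have g: "norm (\<mu> *\<^sub>R g) \<le> K * ?\<eta>"
  proof -
    have "norm (\<mu> *\<^sub>R g) \<le> \<mu> * ((onorm A)\<^sup>2 * ?\<eta>)"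
      using norm_adjoint_comp_le[OF A] \<mu> unfolding g_def by (simp add: mult_left_mono)
    also have "\<dots> \<le> K * ?\<eta>"
      unfolding mult.assoc[symmetric] using \<mu> by (intro mult_right_mono) auto
    finally show ?thesis .
  qed
  have D: "norm D \<le> K * ?\<eta>"
    unfolding D_def
    by (rule order_trans[OF norm_mult_range_perp_le[OF V] order_trans[OF norm_range_perp_mult_le[OF U] g]])
  have grad: "\<mu> *\<^sub>R riem_grad A (A Xs) U V X = \<mu> *\<^sub>R g - D"
    by (simp add: riem_grad_def loss_grad_def tangent_proj_eq g_def D_def linear_diff[OF A]
        scaleR_diff_right scalar_matrix_assoc matrix_scalar_ac)
  have E: "X + - (\<mu> *\<^sub>R riem_grad A (A Xs) U V X) - Xs = H + D"
    by (simp add: grad H_def g_def)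
  have "norm (H + D) \<le> \<epsilon>"
  proof -
    have "H + D = (X - Xs) - \<mu> *\<^sub>R g + D"
      by (simp add: H_def g_def)
    then have "norm (H + D) \<le> ?\<eta> + norm (\<mu> *\<^sub>R g) + norm D"
      using norm_triangle_ineq[of "X - Xs - \<mu> *\<^sub>R g" D] norm_triangle_ineq4[of "X - Xs" "\<mu> *\<^sub>R g"]
      by simp
    then show ?thesis
      using g D by (simp add: \<epsilon>_def algebra_simps)
  qed
  moreover have "2 * ?\<eta> \<le> 2 * \<epsilon>"
    using K by (simp add: \<epsilon>_def algebra_simps)
  \<comment> \<open>This requirement fixes the radius of the basin: the left side is
    \<open>(5 + 2 * K) * ?\<eta>\<close>.\<close>
  moreover have "2 * (2 * ?\<eta>) + \<epsilon> \<le> ?\<sigma> / 2"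
  proof -
    have "(5 + 2 * K) * ?\<eta> \<le> (5 + 2 * K) * (1 / (2 * (5 + 2 * K)) * ?\<sigma>)"
      using basin K by (intro mult_left_mono) auto
    also have "\<dots> = ?\<sigma> / 2"
      using K by (simp add: divide_simps)
    finally show ?thesis
      by (simp add: \<epsilon>_def algebra_simps)
  qed
  ultimately have main: "?\<sigma> * norm (Z - Xs - ((H + D) - range_perp Us ** (H + D) ** range_perp Vs)) \<le> 30 * \<epsilon>\<^sup>2"
    using retraction_expansion[OF ret a c, of \<epsilon>] unfolding E by blast
  have "?\<sigma> * norm (D - range_perp Us ** D ** range_perp Vs) \<le> 2 * (2 * ?\<eta>) * norm (\<mu> *\<^sub>R g)"
    using norm_normal_diff_le[OF a c] unfolding D_def .
  also have "\<dots> \<le> 2 * (2 * ?\<eta>) * (K * ?\<eta>)"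
    using g by (intro mult_left_mono) auto
  finally have normal: "?\<sigma> * norm (D - range_perp Us ** D ** range_perp Vs) \<le> 4 * K * ?\<eta>\<^sup>2"
    by (simp add: power2_eq_square mult_ac)
  have "Z - Xs - (H - range_perp Us ** H ** range_perp Vs) =
      (Z - Xs - ((H + D) - range_perp Us ** (H + D) ** range_perp Vs))
      + (D - range_perp Us ** D ** range_perp Vs)"
    by (simp add: matrix_distribs)
  then have "?\<sigma> * norm (Z - Xs - (H - range_perp Us ** H ** range_perp Vs))
      \<le> ?\<sigma> * (norm (Z - Xs - ((H + D) - range_perp Us ** (H + D) ** range_perp Vs))
        + norm (D - range_perp Us ** D ** range_perp Vs))"
    by (simp only:) (rule mult_left_mono[OF norm_triangle_ineq less_imp_le[OF \<sigma>]])
  then have "?\<sigma> * norm (Z - Xs - (H - range_perp Us ** H ** range_perp Vs))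
      \<le> 30 * \<epsilon>\<^sup>2 + 4 * K * ?\<eta>\<^sup>2"
    unfolding distrib_left using main normal by linarith
  then show ?thesis
    unfolding \<epsilon>_def distrib_right[of "30 * (1 + 2 * K)\<^sup>2"] by (simp only: power_mult_distrib mult.assoc)
qed

section \<open>Vectorization and the residual recursion\<close>

lemma vectorize_diff: "vectorize (X - Y) = vectorize X - vectorize Y"
  by (simp add: vectorize_def vec_eq_iff)

lemma vectorize_scaleR: "vectorize (a *\<^sub>R X) = a *\<^sub>R vectorize X"
  by (simp add: vectorize_def vec_eq_iff)

text \<open>The second-order term is explicit, with constants chosen before the operator, the
  target, the retraction and the run. The quantity bounded by \<open>\<kappa>\<close> is invariant
  under rescaling of \<open>A\<close>, and the factor \<open>1 / min_entry ss\<close> makes the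
  estimate homogeneous under a common rescaling of target and iterates.\<close>

theorem mainTheorem8:
  fixes \<kappa> :: real
  shows "\<exists>c>0. \<exists>C>0.
    \<forall>(A :: real^'n2^'n1 \<Rightarrow> real^'m) (Xs :: real^'n2^'n1)
      (Us :: real^'r^'n1) (ss :: real^'r) (Vs :: real^'r^'n2)
      (y :: real^'m) (\<Theta> :: real^('n2 \<times> 'n1)^('n2 \<times> 'n1))
      (R :: retraction) (X :: nat \<Rightarrow> real^'n2^'n1)
      (U :: nat \<Rightarrow> real^'r^'n1) (V :: nat \<Rightarrow> real^'r^'n2) (\<mu> :: nat \<Rightarrow> real)
      (e :: nat \<Rightarrow> real^('n2 \<times> 'n1)).
      linear A \<longrightarrow>
      rank Xs = CARD('r) \<longrightarrow>
      compact_svd Xs Us ss Vs \<longrightarrow>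
      y = A Xs \<longrightarrow>
      (\<forall>E. vectorize (adjoint A (A E)) = \<Theta> *v vectorize E) \<longrightarrow>
      rgrad_run R A y X U V \<mu> \<longrightarrow>
      (\<forall>t. e t = vectorize (X t - Xs)) \<longrightarrow>
      (\<forall>t. \<mu> t * (onorm A)\<^sup>2 \<le> \<kappa> \<longrightarrow>
           norm (X t - Xs) \<le> c * min_entry ss \<longrightarrow>
           norm (e (Suc t) -
                 ((mat 1 - kron (range_perp Vs) (range_perp Us)) ** (mat 1 - \<mu> t *\<^sub>R \<Theta>)) *v e t)
             \<le> C / min_entry ss * (norm (e t))\<^sup>2)"
proof -
  \<comment> \<open>The maximum keeps the constants below positive also for negative
    \<open>\<kappa>\<close>.\<close>
  define K where "K = max \<kappa> 0"
  define c where "c = 1 / (2 * (5 + 2 * K))"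
  define C where "C = 30 * (1 + 2 * K)\<^sup>2 + 4 * K"
  have K: "0 \<le> K" "\<kappa> \<le> K"
    by (simp_all add: K_def)
  then have "0 < c" "0 < C"
    by (simp_all add: c_def C_def add_pos_nonneg)
  moreover have "norm (e (Suc t) -
        ((mat 1 - kron (range_perp Vs) (range_perp Us)) ** (mat 1 - \<mu> t *\<^sub>R \<Theta>)) *v e t)
      \<le> C / min_entry ss * (norm (e t))\<^sup>2"
    if A: "linear A" and svd: "compact_svd Xs Us ss Vs" and y: "y = A Xs"
      and \<Theta>: "\<forall>E. vectorize (adjoint A (A E)) = \<Theta> *v vectorize E"
      and run: "rgrad_run R A y X U V \<mu>" and e: "\<forall>t. e t = vectorize (X t - Xs)"
      and \<mu>: "\<mu> t * (onorm A)\<^sup>2 \<le> \<kappa>" and basin: "norm (X t - Xs) \<le> c * min_entry ss"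
    for A :: "real^'n2^'n1 \<Rightarrow> real^'m" and Xs :: "real^'n2^'n1"
      and Us :: "real^'r^'n1" and ss :: "real^'r" and Vs :: "real^'r^'n2"
      and y :: "real^'m" and \<Theta> :: "real^('n2 \<times> 'n1)^('n2 \<times> 'n1)"
      and R :: retraction and X :: "nat \<Rightarrow> real^'n2^'n1"
      and U :: "nat \<Rightarrow> real^'r^'n1" and V :: "nat \<Rightarrow> real^'r^'n2" and \<mu> :: "nat \<Rightarrow> real"
      and e :: "nat \<Rightarrow> real^('n2 \<times> 'n1)" and t
  proof -
    define H where "H = X t - Xs - \<mu> t *\<^sub>R adjoint A (A (X t - Xs))"
    obtain s where t: "truncated_svd (X t) (U t) s (V t)"
      using run unfolding rgrad_run_def by blast
    have ret: "retracts R (U t) (V t) (X t) (- (\<mu> t *\<^sub>R riem_grad A (A Xs) (U t) (V t) (X t))) (X (Suc t))"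
      using run unfolding rgrad_run_def Let_def y by blast
    have "\<mu> t = (norm (riem_grad A y (U t) (V t) (X t)))\<^sup>2 / (norm (A (riem_grad A y (U t) (V t) (X t))))\<^sup>2"
      using run unfolding rgrad_run_def Let_def by blast
    \<comment> \<open>A quotient of squares; a vanishing denominator gives the value 0.\<close>
    then have \<mu>t: "0 \<le> \<mu> t"
      by simp
    have "min_entry ss * norm (X (Suc t) - Xs - (H - range_perp Us ** H ** range_perp Vs))
        \<le> C * (norm (X t - Xs))\<^sup>2"
      unfolding C_def H_def
      by (rule rgrad_step_error_le[OF A svd approx_factors_truncated_svd[OF t svd] ret \<mu>t _ K(1)])
        (use \<mu> K basin in \<open>auto simp: c_def\<close>)
    moreover have "e (Suc t) - ((mat 1 - kron (range_perp Vs) (range_perp Us)) ** (mat 1 - \<mu> t *\<^sub>R \<Theta>)) *v e t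
        = vectorize (X (Suc t) - Xs - (H - range_perp Us ** H ** range_perp Vs))"
    proof -
      have "(mat 1 - \<mu> t *\<^sub>R \<Theta>) *v e t = vectorize H"
        using \<Theta> e by (simp add: H_def vectorize_diff vectorize_scaleR
            matrix_vector_mult_diff_rdistrib scaleR_matrix_vector_assoc[symmetric])
      \<comment> \<open>\<open>range_perp Vs\<close> is symmetric, so the transpose in the
        vectorization identity disappears.\<close>
      moreover have "kron (range_perp Vs) (range_perp Us) *v vectorize H
          = vectorize (range_perp Us ** H ** range_perp Vs)"
        using vectorize_matrix_mult[of "range_perp Us" H "range_perp Vs"] by simp
      ultimately show ?thesis
        using e by (simp add: matrix_vector_mul_assoc[symmetric] matrix_vector_mult_diff_rdistrib vectorize_diff)
    qed
    moreover have "norm (e t) = norm (X t - Xs)"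
      using e by (simp add: norm_vectorize)
    ultimately show ?thesis
      using compact_svd_min_entry_pos[OF svd] by (simp add: norm_vectorize field_simps)
  qed
  ultimately show ?thesis
    by (intro exI[of _ c] exI[of _ C] conjI allI impI)
qed

end
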